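(* Let $q$ be a prime power and let $G$ be the non-abelian group with presentation $G=\langle x,y\mid x^n=1=y^2,\ xy=yx^s\rangle$, where $s^2\equiv 1\pmod n$ and $\gcd(2n,q)=1$. Put $d=\gcd(n,s-1)$. Write the factorization of $x^n-1$ into monic irreducible factors in $\mathbb F_q[x]$ as $$x^n-1=f_1f_2\cdots f_r\,f_{r+1}f_{r+1}^{*_s}\,f_{r+2}f_{r+2}^{*_s}\cdots f_{r+t}f_{r+t}^{*_s},$$ where $f_1,\dots,f_r$ are exactly the $s$-self-involutive irreducible factors, and the remaining irreducible factors are grouped into the $t$ pairs $\{f_{r+j},f_{r+j}^{*_s}\}$ with $f_{r+j}\neq f_{r+j}^{*_s}$. For each $i$ let $\xi_i\in\overline{\mathbb F}_q$ be a root of $f_i$. Then $$\mathbb F_qG\cong \bigoplus_{l\mid d} 2\cdot\frac{\phi(l)}{\mathrm{ord}_l q}\,\mathbb F_q(\theta_l)\ \oplus \bigoplus_{\substack{1\le i\le r\\ f_i\nmid x^d-1}} A_i\ \oplus\bigoplus_{\substack{r+1\le i\le r+t\\ f_i\nmid x^d-1}} B_i,$$ where $\theta_l$ is a primitive $l$-th root of unity, $A_i\cong M_2(\mathbb F_q(\xi_i+\xi_i^s,\xi_i^{s+1}))$ and $B_i\cong M_2(\mathbb F_q(\xi_i))$.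
   Context: $\mathbb F_qG$ is the group algebra of $G$ over the field $\mathbb F_q$ with $q$ elements; $\overline{\mathbb F}_q$ is an algebraic closure of $\mathbb F_q$. $\phi$ is Euler's function and $\mathrm{ord}_l q$ is the multiplicative order of $q$ modulo $l$. For a positive integer $k$ and an algebra $K$, $k\cdot K$ denotes the direct sum of $k$ copies of $K$. For a monic $g(x)=(x-a_1)\cdots(x-a_k)\in\mathbb F_q[x]$ with $g(0)\ne0$, $\mathrm{ord}(g)$ is the least $N\ge1$ with $g\mid x^N-1$; for $s$ with $s^2\equiv1\pmod{\mathrm{ord}(g)}$ the $s$-involution is $g^{*_s}(x)=(x-a_1^s)\cdots(x-a_k^s)$, and $g$ is $s$-self-involutive if $g$ and $g^{*_s}$ have the same roots. $M_2(K)$ is the algebra of $2\times2$ matrices over $K$. *)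

theory Defs
  imports
    "HOL-Algebra.Algebraic_Closure_Type"
    "HOL-Algebra.Generated_Fields"
    "HOL-Algebra.Module"
    "HOL-Number_Theory.Number_Theory"
    "HOL-Analysis.Finite_Cartesian_Product"
begin

no_notation fps_nth (infixl \<open>$\<close> 75)

section \<open>Groups given by generators and relations\<close>

text \<open>A letter \<open>(a, True)\<close> stands for the generator \<open>a\<close> and \<open>(a, False)\<close> for its formal inverse.\<close>

type_synonym 'g gword = "('g \<times> bool) list"

definition gen_pow :: "'g \<Rightarrow> int \<Rightarrow> 'g gword" where
  "gen_pow a k = replicate (nat \<bar>k\<bar>) (a, 0 \<le> k)"

text \<open>The least congruence on words that cancels adjacent inverse letters and identifies
  the two sides of each relation in \<open>R\<close>.\<close>

inductive pres_eq :: "('g gword \<times> 'g gword) set \<Rightarrow> 'g gword \<Rightarrow> 'g gword \<Rightarrow> bool"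
  for R where
    pres_refl: "pres_eq R u u"
  | pres_sym: "pres_eq R u v \<Longrightarrow> pres_eq R v u"
  | pres_trans: "pres_eq R u v \<Longrightarrow> pres_eq R v w \<Longrightarrow> pres_eq R u w"
  | pres_cancel: "pres_eq R (u @ [(a, b), (a, \<not> b)] @ v) (u @ v)"
  | pres_rel: "(l, r) \<in> R \<Longrightarrow> pres_eq R (u @ l @ v) (u @ r @ v)"

definition pres_class :: "('g gword \<times> 'g gword) set \<Rightarrow> 'g gword \<Rightarrow> 'g gword set" where
  "pres_class R u = {v. pres_eq R u v}"

definition presented_group :: "('g gword \<times> 'g gword) set \<Rightarrow> 'g gword set monoid" where
  "presented_group R =
     \<lparr>carrier = range (pres_class R),
      monoid.mult = (\<lambda>A B. \<Union>u\<in>A. \<Union>v\<in>B. pres_class R (u @ v)),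
      one = pres_class R []\<rparr>"

lemma pres_eq_append:
  assumes "pres_eq R u u'" and "pres_eq R v v'"
  shows "pres_eq R (u @ v) (u' @ v')"
proof -
  have right: "pres_eq R (x @ w) (y @ w)" if "pres_eq R x y" for x y w
    using that
  proof induction
    case (pres_cancel u a b v)
    then show ?case using pres_eq.pres_cancel[of R u a b "v @ w"] by simp
  next
    case (pres_rel l r u v)
    then show ?case using pres_eq.pres_rel[of l r R u "v @ w"] by simp
  qed (blast intro: pres_eq.intros)+
  have left: "pres_eq R (w @ x) (w @ y)" if "pres_eq R x y" for x y w
    using that
  proof induction
    case (pres_cancel u a b v)
    then show ?case using pres_eq.pres_cancel[of R "w @ u" a b v] by simp
  next
    case (pres_rel l r u v)
    then show ?case using pres_eq.pres_rel[of l r R "w @ u" v] by simp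
  qed (blast intro: pres_eq.intros)+
  show ?thesis
    using right[OF assms(1)] left[OF assms(2)] by (blast intro: pres_trans)
qed

lemma pres_class_eq_iff: "pres_class R u = pres_class R v \<longleftrightarrow> pres_eq R u v"
  unfolding pres_class_def by (auto intro: pres_eq.intros)

lemma presented_group_mult:
  "pres_class R u \<otimes>\<^bsub>presented_group R\<^esub> pres_class R v = pres_class R (u @ v)"
proof -
  have "pres_class R (u' @ v') = pres_class R (u @ v)"
    if "u' \<in> pres_class R u" "v' \<in> pres_class R v" for u' v'
    using that unfolding pres_class_eq_iff
    by (auto simp: pres_class_def intro: pres_eq_append pres_sym)
  moreover have "u \<in> pres_class R u" "v \<in> pres_class R v"
    unfolding pres_class_def by (auto intro: pres_refl)
  ultimately have "(\<Union>u'\<in>pres_class R u. \<Union>v'\<in>pres_class R v. pres_class R (u' @ v'))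
      = pres_class R (u @ v)"
    by blast
  then show ?thesis
    by (simp add: presented_group_def)
qed

lemma group_presented_group: "group (presented_group R)"
proof (rule groupI)
  show "\<one>\<^bsub>presented_group R\<^esub> \<in> carrier (presented_group R)"
    by (simp add: presented_group_def)
next
  fix A assume "A \<in> carrier (presented_group R)"
  then obtain u where u: "A = pres_class R u" by (auto simp: presented_group_def)
  have one: "\<one>\<^bsub>presented_group R\<^esub> = pres_class R []"
    by (simp add: presented_group_def)
  show "\<one>\<^bsub>presented_group R\<^esub> \<otimes>\<^bsub>presented_group R\<^esub> A = A"
    unfolding u one presented_group_mult by simp
  have "\<exists>v. pres_eq R (v @ u) []"
  proof (induction u)
    case Nil
    have "pres_eq R ([] @ []) []" by (simp add: pres_refl)
    then show ?case by blast
  next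
    case (Cons c u)
    then obtain v where v: "pres_eq R (v @ u) []" by blast
    obtain a b where c: "c = (a, b)" by force
    have "pres_eq R ((v @ [(a, \<not> b)]) @ c # u) (v @ u)"
      using pres_cancel[of R v a "\<not> b" u] by (simp add: c)
    with v show ?case by (blast intro: pres_trans)
  qed
  then obtain v where v: "pres_eq R (v @ u) []" by blast
  show "\<exists>B\<in>carrier (presented_group R). B \<otimes>\<^bsub>presented_group R\<^esub> A = \<one>\<^bsub>presented_group R\<^esub>"
  proof
    show "pres_class R v \<otimes>\<^bsub>presented_group R\<^esub> A = \<one>\<^bsub>presented_group R\<^esub>"
      using v unfolding u one presented_group_mult by (simp add: pres_class_eq_iff)
    show "pres_class R v \<in> carrier (presented_group R)"
      by (simp add: presented_group_def)
  qed
next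
  fix A B assume "A \<in> carrier (presented_group R)" and "B \<in> carrier (presented_group R)"
  then obtain u v where u: "A = pres_class R u" and v: "B = pres_class R v"
    by (auto simp: presented_group_def)
  show "A \<otimes>\<^bsub>presented_group R\<^esub> B \<in> carrier (presented_group R)"
    unfolding u v presented_group_mult by (simp add: presented_group_def)
next
  fix A B C assume "A \<in> carrier (presented_group R)" and "B \<in> carrier (presented_group R)"
    and "C \<in> carrier (presented_group R)"
  then obtain u v w where u: "A = pres_class R u" and v: "B = pres_class R v"
    and w: "C = pres_class R w"
    by (auto simp: presented_group_def)
  show "A \<otimes>\<^bsub>presented_group R\<^esub> B \<otimes>\<^bsub>presented_group R\<^esub> C
      = A \<otimes>\<^bsub>presented_group R\<^esub> (B \<otimes>\<^bsub>presented_group R\<^esub> C)"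
    unfolding u v w presented_group_mult by simp
qed

datatype gens = gen_x | gen_y

definition split_metacyclic_rels :: "nat \<Rightarrow> int \<Rightarrow> (gens gword \<times> gens gword) set" where
  "split_metacyclic_rels n s =
     {(gen_pow gen_x (int n), []),
      (gen_pow gen_y 2, []),
      (gen_pow gen_x 1 @ gen_pow gen_y 1, gen_pow gen_y 1 @ gen_pow gen_x s)}"


section \<open>Algebras over a field\<close>

text \<open>
  An algebra over the field of all elements of a type \<open>'f\<close> is represented by a record of type
  \<open>('f, 'm) module\<close>. (The locale \<open>algebra\<close> of HOL-Algebra is restricted to commutative algebras.)
\<close>

definition alg_isomorphic :: "('f, 'm) module \<Rightarrow> ('f, 'k) module \<Rightarrow> bool"
    (infix \<open>\<cong>\<^sub>a\<^sub>l\<^sub>g\<close> 50) where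
  "A \<cong>\<^sub>a\<^sub>l\<^sub>g B \<longleftrightarrow>
     (\<exists>h \<in> ring_iso A B. \<forall>c. \<forall>x \<in> carrier A. h (c \<odot>\<^bsub>A\<^esub> x) = c \<odot>\<^bsub>B\<^esub> h x)"

text \<open>Elements are the finitely supported functions on \<open>G\<close>, extended by 0 outside
  \<open>carrier G\<close>.\<close>

definition group_algebra :: "('g, 'n) monoid_scheme \<Rightarrow> ('f::field, 'g \<Rightarrow> 'f) module" where
  "group_algebra G =
     \<lparr>carrier = {a. finite {g. a g \<noteq> 0} \<and> {g. a g \<noteq> 0} \<subseteq> carrier G},
      monoid.mult = (\<lambda>a b g. \<Sum>(h, k)\<in>{(h, k). a h \<noteq> 0 \<and> b k \<noteq> 0 \<and> h \<otimes>\<^bsub>G\<^esub> k = g}. a h * b k),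
      one = (\<lambda>g. if g = \<one>\<^bsub>G\<^esub> then 1 else 0),
      ring.zero = (\<lambda>g. 0),
      add = (\<lambda>a b g. a g + b g),
      module.smult = (\<lambda>c a g. c * a g)\<rparr>"

text \<open>The direct sum of a family over a finite index set \<open>I\<close>, with componentwise operations.\<close>

definition direct_sum :: "'i set \<Rightarrow> ('i \<Rightarrow> ('f, 'm) module) \<Rightarrow> ('f, 'i \<Rightarrow> 'm) module" where
  "direct_sum I A =
     \<lparr>carrier = (\<Pi>\<^sub>E i\<in>I. carrier (A i)),
      monoid.mult = (\<lambda>u v. \<lambda>i\<in>I. u i \<otimes>\<^bsub>A i\<^esub> v i),
      one = (\<lambda>i\<in>I. \<one>\<^bsub>A i\<^esub>),
      ring.zero = (\<lambda>i\<in>I. \<zero>\<^bsub>A i\<^esub>),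
      add = (\<lambda>u v. \<lambda>i\<in>I. u i \<oplus>\<^bsub>A i\<^esub> v i),
      module.smult = (\<lambda>c u. \<lambda>i\<in>I. c \<odot>\<^bsub>A i\<^esub> u i)\<rparr>"

definition copies :: "nat \<Rightarrow> ('f, 'm) module \<Rightarrow> ('f, nat \<Rightarrow> 'm) module" where
  "copies k A = direct_sum {..<k} (\<lambda>_. A)"

definition direct_sum2 :: "('f, 'm) module \<Rightarrow> ('f, 'k) module \<Rightarrow> ('f, 'm \<times> 'k) module"
    (infixr \<open>\<boxplus>\<close> 65) where
  "A \<boxplus> B =
     \<lparr>carrier = carrier A \<times> carrier B,
      monoid.mult = (\<lambda>(u, u') (v, v'). (u \<otimes>\<^bsub>A\<^esub> v, u' \<otimes>\<^bsub>B\<^esub> v')),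
      one = (\<one>\<^bsub>A\<^esub>, \<one>\<^bsub>B\<^esub>),
      ring.zero = (\<zero>\<^bsub>A\<^esub>, \<zero>\<^bsub>B\<^esub>),
      add = (\<lambda>(u, u') (v, v'). (u \<oplus>\<^bsub>A\<^esub> v, u' \<oplus>\<^bsub>B\<^esub> v')),
      module.smult = (\<lambda>c (u, u'). (c \<odot>\<^bsub>A\<^esub> u, c \<odot>\<^bsub>B\<^esub> u'))\<rparr>"


section \<open>Extensions inside the algebraic closure\<close>

definition adjoin :: "'f::field alg_closure set \<Rightarrow> 'f alg_closure set" where
  "adjoin S = generate_field ring_of_type_algebra (range to_ac \<union> S)"

definition field_algebra :: "'f::field alg_closure set \<Rightarrow> ('f, 'f alg_closure) module" where
  "field_algebra K =
     \<lparr>carrier = K, monoid.mult = (*), one = 1, ring.zero = 0, add = (+),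
      module.smult = (\<lambda>c x. to_ac c * x)\<rparr>"

definition mat2_algebra :: "'f::field alg_closure set \<Rightarrow> ('f, 'f alg_closure ^ 2 ^ 2) module" where
  "mat2_algebra K =
     \<lparr>carrier = {M. \<forall>i j. M $ i $ j \<in> K}, monoid.mult = (**), one = mat 1,
      ring.zero = 0, add = (+), module.smult = (\<lambda>c M. \<chi> i j. to_ac c * M $ i $ j)\<rparr>"

definition primitive_root_of_unity :: "nat \<Rightarrow> 'k::field \<Rightarrow> bool" where
  "primitive_root_of_unity l z \<longleftrightarrow> l > 0 \<and> z ^ l = 1 \<and> (\<forall>k. 0 < k \<and> k < l \<longrightarrow> z ^ k \<noteq> 1)"


section \<open>Involutions of polynomials\<close>

text \<open>
  If \<open>g\<close> is monic with roots \<open>a\<^sub>1, \<dots>, a\<^sub>k\<close> (with multiplicity) in the algebraic closure,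
  this is \<open>(x - a\<^sub>1\<^sup>s) \<cdots> (x - a\<^sub>k\<^sup>s)\<close>. Over a finite field the Frobenius automorphism permutes
  the \<open>a\<^sub>i\<close>, so that product has coefficients in the base field and \<open>of_ac\<close> merely pulls it
  back. The definition is meant for \<open>g\<close> with non-zero constant term and
  \<open>s\<^sup>2 \<equiv> 1\<close> modulo the order of \<open>g\<close>, which holds whenever \<open>g\<close> divides \<open>x\<^sup>n - 1\<close>
  and \<open>s\<^sup>2 \<equiv> 1\<close> modulo \<open>n\<close>.
\<close>

definition involution :: "int \<Rightarrow> 'f::finite_field poly \<Rightarrow> 'f poly" where
  "involution s g =
     map_poly of_ac (\<Prod>a\<in>#proots (map_poly to_ac g). [:- (a powi s), 1:])"

definition self_involutive :: "int \<Rightarrow> 'f::finite_field poly \<Rightarrow> bool" where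
  "self_involutive s g \<longleftrightarrow>
     {a. poly (map_poly to_ac g) a = 0} = {a. poly (map_poly to_ac (involution s g)) a = 0}"

end

theory Submission
  imports Defs "HOL-Analysis.Cartesian_Space"
begin

text \<open>
  Write an element of the group algebra as \<open>a + b y\<close> with polynomials \<open>a, b\<close> in \<open>x\<close>, and evaluate
  \<open>a\<close> and \<open>b\<close> at the \<open>n\<close>-th roots of unity \<open>z\<close> in the algebraic closure. By Fourier inversion this
  identifies the group algebra with the pairs of Frobenius-equivariant functions on these roots; such a
  function is given by arbitrary values in \<open>F(z)\<close> for one \<open>z\<close> in each Frobenius orbit, that is, for one
  root of each irreducible factor of \<open>x\<^sup>n - 1\<close>.

  If \<open>z\<^sup>s = z\<close>, equivalently \<open>z\<^sup>d = 1\<close>, the two characters \<open>a(z) + b(z)\<close> and \<open>a(z) - b(z)\<close> contribute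
  two copies of \<open>F(z)\<close>. Otherwise the matrices with rows \<open>(a(z), b(z))\<close> and
  \<open>(b(z\<^sup>s), a(z\<^sup>s))\<close> form a representation. If \<open>z\<close> and \<open>z\<^sup>s\<close> lie in different orbits, its four entries are
  independent and it is onto the matrix algebra over \<open>F(z)\<close>. If \<open>z\<^sup>s\<close> is a Frobenius conjugate of \<open>z\<close>,
  that conjugation swaps the rows and columns, so conjugating with the matrix with rows \<open>(1, z)\<close> and
  \<open>(1, z\<^sup>s)\<close> yields the matrix algebra over \<open>F(z + z\<^sup>s, z\<^sup>s\<^sup>+\<^sup>1)\<close>.
\<close>

subsection \<open>Field extensions inside the algebraic closure\<close>

text \<open>Bijectivity is obtained from evaluation and interpolation rather than from a dimension
  count, so everything hinges on one set of orbit representatives matched to the target. The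
  factorization offers one root per irreducible factor, whereas the commutative summands are indexed
  by a divisor l of d and a counter. Hence the roots with \<open>z ^ d = 1\<close> are traded for
  representatives of the orbits of primitive l-th roots of unity, each of which generates the same
  field as \<open>\<theta> l\<close>. The arithmetic hypotheses enter at definite places: n is
  invertible in the base field, which gives n distinct roots of unity and the inverse Fourier
  transform; odd q lets the two characters separate a(z) from b(z); s^2 = 1 modulo n makes z -> z^s
  an involution of the roots and keeps the normal forms x^i y^b distinct. The integer s is traded
  early for its residue \<open>S\<close> modulo n, so that the representations involve natural
  powers only.\<close>

lemma minus_ring_of_type_algebra: "\<ominus>\<^bsub>ring_of_type_algebra\<^esub> x = - (x :: 'a::field)"
proof -
  interpret R: field "ring_of_type_algebra :: 'a ring" by (rule field_from_type_algebra)
  show ?thesis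
    by (rule R.minus_equality) (simp_all add: ring_of_type_algebra_def)
qed

lemma inv_ring_of_type_algebra:
  assumes "x \<noteq> (0 :: 'a::field)"
  shows "inv\<^bsub>ring_of_type_algebra\<^esub> x = inverse x"
proof -
  interpret R: field "ring_of_type_algebra :: 'a ring" by (rule field_from_type_algebra)
  show ?thesis
    by (rule R.comm_inv_char) (use assms in \<open>simp_all add: ring_of_type_algebra_def\<close>)
qed

lemma adjoin_base: "to_ac c \<in> adjoin S"
  unfolding adjoin_def by (rule generate_field.incl) simp

lemma adjoin_gen: "x \<in> S \<Longrightarrow> x \<in> adjoin S"
  unfolding adjoin_def by (rule generate_field.incl) simp

lemma adjoin_0: "0 \<in> adjoin S" and adjoin_1: "1 \<in> adjoin S"
  using adjoin_base[of 0 S] adjoin_base[of 1 S] by simp_all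

lemma adjoin_uminus: "x \<in> adjoin S \<Longrightarrow> - x \<in> adjoin S"
  unfolding adjoin_def
  using generate_field.a_inv[of x "ring_of_type_algebra" "range to_ac \<union> S"]
  by (simp add: minus_ring_of_type_algebra)

lemma adjoin_add: "x \<in> adjoin S \<Longrightarrow> y \<in> adjoin S \<Longrightarrow> x + y \<in> adjoin S"
  unfolding adjoin_def
  using generate_field.eng_add[of x "ring_of_type_algebra" "range to_ac \<union> S" y]
  by (simp add: ring_of_type_algebra_def)

lemma adjoin_mult: "x \<in> adjoin S \<Longrightarrow> y \<in> adjoin S \<Longrightarrow> x * y \<in> adjoin S"
  unfolding adjoin_def
  using generate_field.eng_mult[of x "ring_of_type_algebra" "range to_ac \<union> S" y]
  by (simp add: ring_of_type_algebra_def)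

lemma adjoin_inverse: "x \<in> adjoin S \<Longrightarrow> inverse x \<in> adjoin S"
proof (cases "x = 0")
  case False
  assume "x \<in> adjoin S"
  then show ?thesis
    using False generate_field.m_inv[of x "ring_of_type_algebra" "range to_ac \<union> S"]
    unfolding adjoin_def by (simp add: inv_ring_of_type_algebra) (simp add: ring_of_type_algebra_def)
qed simp

lemma adjoin_diff: "x \<in> adjoin S \<Longrightarrow> y \<in> adjoin S \<Longrightarrow> x - y \<in> adjoin S"
  using adjoin_add[of x S "- y"] adjoin_uminus[of y S] by simp

lemma adjoin_divide: "x \<in> adjoin S \<Longrightarrow> y \<in> adjoin S \<Longrightarrow> x / y \<in> adjoin S"
  by (simp add: divide_inverse adjoin_mult adjoin_inverse)

lemma adjoin_power: "x \<in> adjoin S \<Longrightarrow> x ^ k \<in> adjoin S"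
  by (induction k) (simp_all add: adjoin_1 adjoin_mult)

lemma adjoin_sum: "(\<And>i. i \<in> A \<Longrightarrow> h i \<in> adjoin S) \<Longrightarrow> sum h A \<in> adjoin S"
  by (induction A rule: infinite_finite_induct) (simp_all add: adjoin_0 adjoin_add)

lemmas adjoin_closed = adjoin_base adjoin_0 adjoin_1 adjoin_uminus adjoin_add adjoin_mult
  adjoin_inverse adjoin_diff adjoin_divide adjoin_power adjoin_sum

lemma adjoin_induct [consumes 1, case_names gen base uminus add mult inverse]:
  assumes "x \<in> adjoin S"
    and gen: "\<And>x. x \<in> S \<Longrightarrow> P x" and base: "\<And>c. P (to_ac c)"
    and uminus: "\<And>x. P x \<Longrightarrow> P (- x)"
    and add: "\<And>x y. P x \<Longrightarrow> P y \<Longrightarrow> P (x + y)" and mult: "\<And>x y. P x \<Longrightarrow> P y \<Longrightarrow> P (x * y)"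
    and inverse: "\<And>x. P x \<Longrightarrow> x \<noteq> 0 \<Longrightarrow> P (inverse x)"
  shows "P x"
  using assms(1) unfolding adjoin_def
proof induction
  case one
  then show ?case using base[of 1] by (simp add: ring_of_type_algebra_def)
next
  case (incl h)
  then show ?case using gen base by auto
next
  case (a_inv h)
  then show ?case using uminus by (simp add: minus_ring_of_type_algebra)
next
  case (m_inv h)
  then have "h \<noteq> 0" by (simp add: ring_of_type_algebra_def)
  with m_inv inverse show ?case by (simp add: inv_ring_of_type_algebra)
next
  case (eng_add h1 h2)
  then show ?case using add by (simp add: ring_of_type_algebra_def)
next
  case (eng_mult h1 h2)
  then show ?case using mult by (simp add: ring_of_type_algebra_def)
qed

lemma adjoin_subset: "S \<subseteq> adjoin T \<Longrightarrow> adjoin S \<subseteq> adjoin T"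
proof
  fix x assume S: "S \<subseteq> adjoin T" and "x \<in> adjoin S"
  from this(2) show "x \<in> adjoin T"
    by (induction rule: adjoin_induct) (use S in \<open>auto intro: adjoin_closed\<close>)
qed

text \<open>Applied to \<open>z\<close> and \<open>z ^ S\<close>, which are powers of each other
  because \<open>S * S\<close> is 1 modulo n, and to two primitive roots of unity of the same
  order.\<close>

lemma adjoin_singleton_powers_eq:
  assumes "y = x ^ i" and "x = y ^ j"
  shows "adjoin {x} = adjoin {y}"
proof
  show "adjoin {x} \<subseteq> adjoin {y}"
    using assms(2) adjoin_power[OF adjoin_gen[of y "{y}"]] by (intro adjoin_subset) auto
  show "adjoin {y} \<subseteq> adjoin {x}"
    using assms(1) adjoin_power[OF adjoin_gen[of x "{x}"]] by (intro adjoin_subset) auto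
qed

subsection \<open>The Frobenius map\<close>

locale galois_field =
  fixes base :: "'f::finite_field itself" and q :: nat
  assumes primepow_q: "primepow q" and card_base: "CARD('f) = q"
begin

text \<open>The freshman's dream concerns powers of the characteristic. The prime underlying
  \<open>q\<close> is that characteristic, since \<open>CHAR('f)\<close> divides the cardinality
  \<open>q\<close>.\<close>

lemma q_eq_CHAR_power: "\<exists>m. q = CHAR('f) ^ m"
proof -
  obtain p m where p: "prime p" "q = p ^ m" "m > 0"
    using primepow_q unfolding primepow_def by blast
  have pc: "prime CHAR('f)" by (rule prime_CHAR_semidom) (rule CHAR_pos)
  have "CHAR('f) dvd p ^ m" using CHAR_dvd_CARD[where 'a = 'f] card_base p by simp
  then have "CHAR('f) dvd p" using pc prime_dvd_power by blast
  then have "CHAR('f) = p" using pc p(1) primes_dvd_imp_eq by blast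
  with p show ?thesis by blast
qed

lemma q_gt_1: "q > 1"
  using primepow_q by (rule primepow_gt_Suc_0[unfolded One_nat_def[symmetric]])

lemma frob_add: "(x + y :: 'f alg_closure) ^ (q ^ k) = x ^ (q ^ k) + y ^ (q ^ k)"
proof -
  obtain m where "q = CHAR('f) ^ m" using q_eq_CHAR_power by blast
  then have "q ^ k = CHAR('f alg_closure) ^ (m * k)" by (simp add: power_mult)
  moreover have "prime CHAR('f alg_closure)" by (simp add: prime_CHAR_semidom CHAR_pos)
  ultimately show ?thesis by (intro freshmans_dream')
qed

lemma frob_uminus: "(- x :: 'f alg_closure) ^ (q ^ k) = - (x ^ (q ^ k))"
proof -
  have "x ^ (q ^ k) + (- x) ^ (q ^ k) = (x + - x) ^ (q ^ k)" by (rule frob_add[symmetric])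
  also have "\<dots> = 0" using q_gt_1 by simp
  finally show ?thesis by (simp add: add_eq_0_iff)
qed

lemma frob_diff: "(x - y :: 'f alg_closure) ^ (q ^ k) = x ^ (q ^ k) - y ^ (q ^ k)"
  using frob_add[of x "- y" k] frob_uminus[of y k] by simp

lemma frob_sum: "(sum h A :: 'f alg_closure) ^ (q ^ k) = (\<Sum>i\<in>A. h i ^ (q ^ k))"
  by (induction A rule: infinite_finite_induct) (use q_gt_1 in \<open>simp_all add: frob_add\<close>)

lemma frob_base: "(to_ac (c :: 'f)) ^ (q ^ k) = to_ac c"
  using finite_field_power_card_power_eq_same[of "q ^ k" k c] card_base
  by (simp flip: to_ac_power)

text \<open>The polynomial x^q - x has at most \<open>q\<close> roots, and the \<open>q\<close>
  elements of the base field already exhaust them. This is the test by which elements of the closure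
  are later pulled back along \<open>of_ac\<close>.\<close>

lemma frob_fixed_iff_base: "(z :: 'f alg_closure) ^ q = z \<longleftrightarrow> z \<in> range to_ac"
proof
  assume z: "z ^ q = z"
  define P :: "'f alg_closure poly" where "P = monom 1 q - monom 1 1"
  have deg: "degree P = q"
    unfolding P_def diff_conv_add_uminus using q_gt_1
    by (subst degree_add_eq_left) (auto simp: degree_monom_eq)
  have "P \<noteq> 0" using deg q_gt_1 by auto
  then have fin: "finite {x. poly P x = 0}" and le: "card {x. poly P x = 0} \<le> q"
    using poly_roots_finite[of P] card_poly_roots_bound[of P] deg by auto
  have sub: "range (to_ac :: 'f \<Rightarrow> _) \<subseteq> {x. poly P x = 0}"
    using frob_base[of _ 1] by (auto simp: P_def poly_monom)
  have "card (range (to_ac :: 'f \<Rightarrow> _)) = q"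
    using card_base by (simp add: card_image inj_to_ac)
  with fin le sub have "range (to_ac :: 'f \<Rightarrow> _) = {x. poly P x = 0}"
    by (intro card_subset_eq) (auto intro: antisym card_mono)
  then show "z \<in> range to_ac" using z by (auto simp: P_def poly_monom)
next
  assume "z \<in> range to_ac"
  then show "z ^ q = z" using frob_base[of _ 1] by auto
qed

text \<open>Both powers of Frobenius are field homomorphisms over the base field, so the elements on
  which they agree form a subfield. With \<open>j = 0\<close> this yields fixed elements; in general
  it makes the conjugate of an element of F(z) depend only on the conjugate of z.\<close>

lemma frob_eq_on_adjoin:
  assumes "w \<in> adjoin (A :: 'f alg_closure set)" and "\<And>z. z \<in> A \<Longrightarrow> z ^ (q ^ i) = z ^ (q ^ j)"
  shows "w ^ (q ^ i) = w ^ (q ^ j)"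
  using assms(1)
  by (induction rule: adjoin_induct)
     (simp_all add: assms(2) frob_base frob_add frob_uminus power_mult_distrib power_inverse)

lemma frob_poly_eval:
  "poly (map_poly to_ac (p :: 'f poly)) (z ^ (q ^ k)) = poly (map_poly to_ac p) z ^ (q ^ k)"
  by (simp add: poly_altdef frob_sum power_mult_distrib coeff_map_poly frob_base degree_map_poly
           flip: power_mult) (simp add: mult.commute)

end

subsection \<open>Irreducible polynomials and involutions\<close>

lemma map_poly_to_ac_add: "map_poly to_ac (p + r) = map_poly to_ac p + map_poly to_ac r"
  by (rule poly_eqI) (simp add: coeff_map_poly)

lemma map_poly_to_ac_diff: "map_poly to_ac (p - r) = map_poly to_ac p - map_poly to_ac r"
  by (rule poly_eqI) (simp add: coeff_map_poly)

lemma map_poly_to_ac_mult: "map_poly to_ac (p * r) = map_poly to_ac p * map_poly to_ac r"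
  by (rule poly_eqI) (simp add: coeff_map_poly coeff_mult to_ac_sum)

lemma map_poly_to_ac_prod: "map_poly to_ac (\<Prod>i\<in>A. p i) = (\<Prod>i\<in>A. map_poly to_ac (p i))"
  by (induction A rule: infinite_finite_induct) (simp_all add: map_poly_to_ac_mult)

lemma map_poly_to_ac_monom_diff_1: "map_poly to_ac (monom 1 m - 1) = monom 1 m - 1"
  by (simp add: map_poly_to_ac_diff map_poly_monom)

lemma poly_to_ac_eq_0_if_dvd:
  assumes "p dvd r" and "poly (map_poly to_ac p) z = 0"
  shows "poly (map_poly to_ac r) z = 0"
  using assms by (auto simp: dvd_def map_poly_to_ac_mult)

text \<open>A nonzero polynomial of least degree vanishing at \<open>z\<close> is the minimal
  polynomial: division with remainder makes it divide every polynomial with that root. It is no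
  unit, so irreducibility makes it an associate of \<open>f\<close>.\<close>

lemma irreducible_dvd_if_common_root:
  fixes f g :: "'a::field poly"
  assumes irr: "irreducible f"
    and f: "poly (map_poly to_ac f) z = 0" and g: "poly (map_poly to_ac g) z = 0"
  shows "f dvd g"
proof -
  define I where "I = (\<lambda>p :: 'a poly. p \<noteq> 0 \<and> poly (map_poly to_ac p) z = 0)"
  have "I f" using irr f by (auto simp: I_def)
  define p where "p = arg_min degree I"
  have p: "I p" and min: "\<And>h. I h \<Longrightarrow> degree p \<le> degree h"
    using arg_min_nat_lemma[of I f degree] \<open>I f\<close> by (auto simp: p_def)
  have dvd: "p dvd h" if h: "poly (map_poly to_ac h) z = 0" for h
  proof -
    have "h = h div p * p + h mod p" by simp
    then have "map_poly to_ac h = map_poly to_ac (h div p) * map_poly to_ac p + map_poly to_ac (h mod p)"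
      by (metis map_poly_to_ac_add map_poly_to_ac_mult)
    with h p have "poly (map_poly to_ac (h mod p)) z = 0" by (auto simp: I_def)
    moreover have "\<not> I (h mod p)"
      using min[of "h mod p"] degree_mod_less[of p h] p by (auto simp: I_def)
    ultimately show ?thesis by (auto simp: I_def mod_eq_0_iff_dvd)
  qed
  have "\<not> is_unit p"
  proof
    assume "is_unit p"
    from poly_to_ac_eq_0_if_dvd[OF this, of z] p show False by (simp add: I_def)
  qed
  moreover obtain k where k: "f = p * k" using dvd[OF f] by (auto elim: dvdE)
  ultimately have "is_unit k" using irr irreducibleD by blast
  then have "f dvd p" unfolding k by simp
  with dvd[OF g] show ?thesis by (rule dvd_trans[rotated])
qed

section \<open>Polynomials rebuilt from their multisets of roots\<close>

lemma poly_prod_mset_linear_eq_0_iff: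
  "poly (\<Prod>a\<in>#A. [:- a, 1:]) (x :: 'a::idom) = 0 \<longleftrightarrow> x \<in># A"
  by (induction A) auto

lemma proots_prod_mset_linear: "proots (\<Prod>a\<in>#A. [:- a, 1:]) = (A :: 'a::idom multiset)"
proof (induction A)
  case (add x A)
  have "(\<Prod>a\<in>#A. [:- a, 1:]) \<noteq> 0" by (auto simp: prod_mset_zero_iff)
  then have "proots ([:- x, 1:] * (\<Prod>a\<in>#A. [:- a, 1:])) = {#x#} + A"
    using add by (subst proots_mult) (auto simp del: mult_pCons_left)
  then show ?case by simp
qed simp

lemma alg_closed_eq_prod_proots:
  fixes p :: "'a::alg_closed_field poly"
  assumes "p \<noteq> 0"
  shows "p = smult (lead_coeff p) (\<Prod>a\<in>#proots p. [:- a, 1:])"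
proof -
  obtain A where A: "p = smult (lead_coeff p) (\<Prod>a\<in>#A. [:- a, 1:])"
    using alg_closed_imp_factorization[OF assms] by blast
  have "proots p = A"
    using assms by (subst A) (simp add: proots_prod_mset_linear)
  with A show ?thesis by simp
qed

context galois_field
begin

lemma frob_inj: "(x :: 'f alg_closure) ^ (q ^ k) = y ^ (q ^ k) \<Longrightarrow> x = y"
  using frob_diff[of x y k] by simp

lemma map_poly_frob_mult:
  fixes p r :: "'f alg_closure poly"
  shows "map_poly (\<lambda>x. x ^ q) (p * r) = map_poly (\<lambda>x. x ^ q) p * map_poly (\<lambda>x. x ^ q) r"
  using q_gt_1 frob_sum[where k = 1 and A = "{.._ :: nat}"]
  by (intro poly_eqI) (simp add: coeff_map_poly coeff_mult power_mult_distrib)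

lemma map_poly_frob_prod_linear:
  "map_poly (\<lambda>x. x ^ q) (\<Prod>a\<in>#A. [:- a, 1:])
     = (\<Prod>a\<in>#image_mset (\<lambda>x. x ^ q) A. [:- a, 1 :: 'f alg_closure:])"
proof (induction A)
  case empty
  show ?case using q_gt_1 by simp
next
  case (add x A)
  have "map_poly (\<lambda>x. x ^ q) [:- x, 1:] = [:- (x ^ q), 1:]"
    using q_gt_1 frob_uminus[of x 1] by (simp add: map_poly_pCons)
  with add show ?case by (simp add: map_poly_frob_mult del: mult_pCons_left mult_pCons_right)
qed

text \<open>Applying Frobenius to the coefficients permutes the linear factors, so every coefficient
  is fixed by it and lies in the base field, where \<open>of_ac\<close> inverts
  \<open>to_ac\<close>.\<close>

lemma frob_stable_prod_descends:
  fixes A :: "'f alg_closure multiset"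
  assumes "image_mset (\<lambda>x. x ^ q) A = A"
  shows "map_poly to_ac (map_poly of_ac (\<Prod>a\<in>#A. [:- a, 1:])) = (\<Prod>a\<in>#A. [:- a, 1:])"
    (is "_ = ?P")
proof (rule poly_eqI)
  fix i
  have "map_poly (\<lambda>x. x ^ q) ?P = ?P" by (simp only: map_poly_frob_prod_linear assms)
  then have "coeff (map_poly (\<lambda>x. x ^ q) ?P) i = coeff ?P i" by (rule arg_cong)
  moreover have "coeff (map_poly (\<lambda>x. x ^ q) ?P) i = coeff ?P i ^ q"
    using q_gt_1 by (intro coeff_map_poly) simp
  ultimately have "coeff ?P i ^ q = coeff ?P i" by (rule trans[OF sym, rotated])
  then have "coeff ?P i \<in> range to_ac" by (simp add: frob_fixed_iff_base)
  then show "coeff (map_poly to_ac (map_poly of_ac ?P)) i = coeff ?P i"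
    by (simp add: coeff_map_poly to_ac_of_ac)
qed

text \<open>The product of the linear factors over the orbit of \<open>z\<close> descends to the
  base field and shares the root \<open>z\<close> with \<open>f\<close>, so \<open>f\<close> divides
  it and has no roots outside the orbit.\<close>

lemma irreducible_roots_conjugate:
  fixes f :: "'f poly"
  assumes irr: "irreducible f"
    and z: "poly (map_poly to_ac f) z = 0" and w: "poly (map_poly to_ac f) w = 0"
  shows "\<exists>k. w = z ^ (q ^ k)"
proof -
  define Orb where "Orb = range (\<lambda>k. z ^ (q ^ k))"
  have "map_poly to_ac f \<noteq> 0" using irr by (auto simp: map_poly_eq_0_iff)
  then have "finite {x. poly (map_poly to_ac f) x = 0}" by (rule poly_roots_finite)
  moreover have "Orb \<subseteq> {x. poly (map_poly to_ac f) x = 0}"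
    using z q_gt_1 by (auto simp: Orb_def frob_poly_eval)
  ultimately have fin: "finite Orb" by (rule finite_subset[rotated])
  have "inj_on (\<lambda>x. x ^ q) Orb" by (rule inj_onI) (use frob_inj[of _ 1] in auto)
  moreover have "(\<lambda>x. x ^ q) ` Orb \<subseteq> Orb"
  proof -
    have "(z ^ q ^ k) ^ q = z ^ (q ^ Suc k)" for k by (simp add: mult.commute flip: power_mult)
    then show ?thesis unfolding Orb_def by blast
  qed
  ultimately have "image_mset (\<lambda>x. x ^ q) (mset_set Orb) = mset_set Orb"
    using fin by (simp add: image_mset_mset_set endo_inj_surj)
  note g = frob_stable_prod_descends[OF this]
  have root: "poly (map_poly to_ac (map_poly of_ac (\<Prod>a\<in>#mset_set Orb. [:- a, 1:]))) x = 0 \<longleftrightarrow> x \<in> Orb" for x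
    unfolding g poly_prod_mset_linear_eq_0_iff using fin by simp
  have "z \<in> Orb" unfolding Orb_def by (rule range_eqI[of _ _ 0]) simp
  with irr z have "f dvd map_poly of_ac (\<Prod>a\<in>#mset_set Orb. [:- a, 1:])"
    using irreducible_dvd_if_common_root root by blast
  with w have "w \<in> Orb" using poly_to_ac_eq_0_if_dvd root by blast
  then show ?thesis by (auto simp: Orb_def)
qed

text \<open>\<open>involution\<close> pulls a product back by \<open>of_ac\<close>, which is
  harmless once the product is Frobenius stable. The roots of \<open>g\<close> are permuted with
  multiplicity because the coefficients are fixed, and raising to the power \<open>s\<close>
  commutes with Frobenius.\<close>

lemma poly_involution_eq_0_iff:
  fixes g :: "'f poly"
  assumes "g \<noteq> 0"
  shows "poly (map_poly to_ac (involution s g)) z = 0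
    \<longleftrightarrow> (\<exists>a. poly (map_poly to_ac g) a = 0 \<and> z = a powi s)"
proof -
  define P where "P = map_poly to_ac g"
  have "P \<noteq> 0" using assms by (simp add: P_def map_poly_eq_0_iff)
  have "map_poly (\<lambda>x. x ^ q) P = P"
    using q_gt_1 frob_base[of _ 1] by (intro poly_eqI) (simp add: P_def coeff_map_poly)
  moreover have "map_poly (\<lambda>x. x ^ q) P
      = smult (lead_coeff P ^ q) (\<Prod>a\<in>#image_mset (\<lambda>x. x ^ q) (proots P). [:- a, 1:])"
  proof -
    have "map_poly (\<lambda>x. x ^ q) P = map_poly (\<lambda>x. x ^ q)
        ([:lead_coeff P:] * (\<Prod>a\<in>#proots P. [:- a, 1:]))"
      using alg_closed_eq_prod_proots[OF \<open>P \<noteq> 0\<close>] by simp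
    also have "\<dots> = [:lead_coeff P ^ q:] * (\<Prod>a\<in>#image_mset (\<lambda>x. x ^ q) (proots P). [:- a, 1:])"
      unfolding map_poly_frob_mult map_poly_frob_prod_linear
      using q_gt_1 by (simp add: map_poly_pCons)
    finally show ?thesis by simp
  qed
  ultimately have "P = smult (lead_coeff P ^ q) (\<Prod>a\<in>#image_mset (\<lambda>x. x ^ q) (proots P). [:- a, 1:])"
    by simp
  then have stable: "image_mset (\<lambda>x. x ^ q) (proots P) = proots P"
    using \<open>P \<noteq> 0\<close> proots_smult[of "lead_coeff P ^ q" "\<Prod>a\<in>#image_mset (\<lambda>x. x ^ q) (proots P). [:- a, 1:]"]
    unfolding proots_prod_mset_linear by simp
  have "image_mset (\<lambda>x. x ^ q) (image_mset (\<lambda>a. a powi s) (proots P))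
      = image_mset (\<lambda>a. a powi s) (image_mset (\<lambda>x. x ^ q) (proots P))"
  proof -
    have "(a powi s) ^ q = (a ^ q) powi s" for a :: "'f alg_closure"
      by (simp only: power_int_of_nat[symmetric] power_int_mult[symmetric] mult.commute)
    then show ?thesis by (simp add: image_mset.compositionality o_def)
  qed
  then have "image_mset (\<lambda>x. x ^ q) (image_mset (\<lambda>a. a powi s) (proots P))
      = image_mset (\<lambda>a. a powi s) (proots P)"
    by (simp only: stable)
  note frob_stable_prod_descends[OF this]
  moreover have "involution s g
      = map_poly of_ac (\<Prod>a\<in>#image_mset (\<lambda>a. a powi s) (proots P). [:- a, 1:])"
    by (simp add: involution_def P_def image_mset.compositionality o_def)
  ultimately have "map_poly to_ac (involution s g)
      = (\<Prod>a\<in>#image_mset (\<lambda>a. a powi s) (proots P). [:- a, 1:])"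
    by (simp only:)
  then have "poly (map_poly to_ac (involution s g)) z = 0 \<longleftrightarrow> z \<in># image_mset (\<lambda>a. a powi s) (proots P)"
    by (simp only: poly_prod_mset_linear_eq_0_iff)
  then show ?thesis using \<open>P \<noteq> 0\<close> by (auto simp: P_def)
qed

end

subsection \<open>Interpolation on Frobenius orbits\<close>

lemma size_proots_alg_closed:
  fixes p :: "'a::alg_closed_field poly"
  assumes "p \<noteq> 0"
  shows "size (proots p) = degree p"
proof -
  obtain A where A: "size A = degree p" "p = smult (lead_coeff p) (\<Prod>a\<in>#A. [:- a, 1:])"
    using alg_closed_imp_factorization[OF assms] by blast
  have "proots p = A"
    using assms by (subst A(2)) (simp add: proots_prod_mset_linear)
  with A(1) show ?thesis by simp
qed

lemma poly_to_ac_sum_monom: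
  "poly (map_poly to_ac (\<Sum>i<n. monom (c i) i)) z = (\<Sum>i<n. to_ac (c i) * z ^ i)"
  by (induction n) (simp_all add: map_poly_to_ac_add map_poly_monom poly_monom)

locale coprime_galois_field = galois_field base q for base :: "'f::finite_field itself" and q +
  fixes n :: nat
  assumes n_pos: "n > 0" and coprime_n_q: "coprime n q"
begin

lemma of_nat_n_nonzero: "(of_nat n :: 'f alg_closure) \<noteq> 0"
proof
  assume "of_nat n = (0 :: 'f alg_closure)"
  then have "CHAR('f) dvd n" by (simp add: of_nat_eq_0_iff_char_dvd)
  moreover have "CHAR('f) dvd q" using CHAR_dvd_CARD[where 'a = 'f] card_base by simp
  moreover have "prime CHAR('f)" by (rule prime_CHAR_semidom) (rule CHAR_pos)
  ultimately show False
    using coprime_n_q by (meson coprime_common_divisor not_prime_unit)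
qed

text \<open>At a double root the derivative n x^(n-1) would vanish as well. Since n is nonzero in
  the field, the root would be 0, which is no root of unity.\<close>

lemma monom_diff_1_no_double_root:
  "\<not> [:- a, 1:] * [:- a, 1:] dvd (monom 1 n - 1 :: 'f alg_closure poly)"
proof
  assume "[:- a, 1:] * [:- a, 1:] dvd (monom 1 n - 1 :: 'f alg_closure poly)"
  then obtain r where r: "(monom 1 n - 1 :: 'f alg_closure poly) = [:- a, 1:] * ([:- a, 1:] * r)"
    by (metis dvdE mult.assoc)
  from arg_cong[OF r, of "\<lambda>p. poly p a"] have an: "a ^ n = 1" by (simp add: poly_monom)
  have "poly (pderiv (monom 1 n - 1)) a = 0"
    unfolding r pderiv_mult by simp
  then have "of_nat n * a ^ (n - 1) = 0"
    by (simp add: pderiv_diff pderiv_monom poly_monom)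
  with of_nat_n_nonzero have "a = 0" by simp
  with an n_pos show False by (simp add: zero_power)
qed

lemma degree_monom_diff_1: "degree (monom 1 n - 1 :: 'f alg_closure poly) = n"
  unfolding diff_conv_add_uminus using n_pos
  by (subst degree_add_eq_left) (auto simp: degree_monom_eq)

lemma monom_diff_1_nonzero: "(monom 1 n - 1 :: 'f alg_closure poly) \<noteq> 0"
  using degree_monom_diff_1 n_pos by auto

lemma roots_of_unity_eq: "{z :: 'f alg_closure. z ^ n = 1} = {z. poly (monom 1 n - 1) z = 0}"
  by (simp add: poly_monom)

lemma finite_roots_of_unity: "finite {z :: 'f alg_closure. z ^ n = 1}"
  unfolding roots_of_unity_eq by (rule poly_roots_finite[OF monom_diff_1_nonzero])

lemma card_roots_of_unity: "card {z :: 'f alg_closure. z ^ n = 1} = n"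
proof -
  let ?P = "monom 1 n - 1 :: 'f alg_closure poly"
  have order: "order a ?P = 1" if "a ^ n = 1" for a
  proof -
    have "\<not> 2 \<le> order a ?P"
      using monom_diff_1_no_double_root[of a] order_divides[of a 2 ?P] monom_diff_1_nonzero
      by (simp add: power2_eq_square del: mult_pCons_left)
    moreover have "order a ?P \<noteq> 0"
      using that order_root[of ?P a] monom_diff_1_nonzero by (simp add: poly_monom)
    ultimately show ?thesis by simp
  qed
  have set: "set_mset (proots ?P) = {z. z ^ n = 1}"
    using monom_diff_1_nonzero by (auto simp: poly_monom)
  have "n = size (proots ?P)"
    using size_proots_alg_closed[OF monom_diff_1_nonzero] degree_monom_diff_1 by simp
  also have "\<dots> = (\<Sum>a\<in>{z. z ^ n = 1}. count (proots ?P) a)"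
    unfolding size_multiset_overloaded_eq set ..
  also have "\<dots> = (\<Sum>a\<in>{z :: 'f alg_closure. z ^ n = 1}. 1)"
    by (rule sum.cong) (use order monom_diff_1_nonzero in auto)
  finally show ?thesis by simp
qed

text \<open>Uniqueness concerns the index \<open>j\<close> only; the exponent \<open>k\<close>
  matters only modulo the length of the orbit. The index type is left open because the
  representatives come first from pairs and later from a disjoint sum.\<close>

definition orbit_reps :: "'j set \<Rightarrow> ('j \<Rightarrow> 'f alg_closure) \<Rightarrow> bool" where
  "orbit_reps J \<rho> \<longleftrightarrow> (\<forall>j\<in>J. \<rho> j ^ n = 1) \<and>
     (\<forall>z. z ^ n = 1 \<longrightarrow> (\<exists>!j. j \<in> J \<and> (\<exists>k. z = \<rho> j ^ (q ^ k))))"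

lemma frob_eval:
  "(\<Sum>i<m. to_ac (c i :: 'f) * (z ^ (q ^ k)) ^ i) = (\<Sum>i<m. to_ac (c i) * z ^ i) ^ (q ^ k)"
  unfolding poly_to_ac_sum_monom[symmetric] by (rule frob_poly_eval)

text \<open>Equivariance spreads the vanishing to all \<open>n\<close> roots of unity, too many
  zeros for a polynomial of degree below \<open>n\<close>.\<close>

lemma orbit_reps_eval_unique:
  fixes c :: "nat \<Rightarrow> 'f"
  assumes reps: "orbit_reps J \<rho>" and zero: "\<And>j. j \<in> J \<Longrightarrow> (\<Sum>i<n. to_ac (c i) * \<rho> j ^ i) = 0"
    and "i < n"
  shows "c i = 0"
proof -
  define P where "P = map_poly to_ac (\<Sum>i<n. monom (c i) i)"
  have "poly P z = 0" if z: "z ^ n = 1" for z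
  proof -
    obtain j k where "j \<in> J" and k: "z = \<rho> j ^ (q ^ k)" using reps z unfolding orbit_reps_def by blast
    from zero[OF this(1)] q_gt_1 show ?thesis
      unfolding P_def poly_to_ac_sum_monom k frob_eval by simp
  qed
  then have sub: "{z. z ^ n = 1} \<subseteq> {z. poly P z = 0}" by blast
  have "degree P < n"
  proof -
    have "degree P \<le> n - 1"
      unfolding P_def by (rule degree_le) (auto simp: coeff_map_poly coeff_sum)
    with n_pos show ?thesis by simp
  qed
  have "P = 0"
  proof (rule ccontr)
    assume "P \<noteq> 0"
    then have "n \<le> card {z. poly P z = 0}"
      using card_mono[OF poly_roots_finite[of P] sub] card_roots_of_unity by simp
    also have "\<dots> \<le> degree P" by (rule card_poly_roots_bound[OF \<open>P \<noteq> 0\<close>])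
    finally show False using \<open>degree P < n\<close> by simp
  qed
  then have "coeff P i = 0" by simp
  with \<open>i < n\<close> show ?thesis by (simp add: P_def coeff_map_poly coeff_sum if_distrib cong: if_cong)
qed

text \<open>The prescribed values extend to a Frobenius-equivariant function on the \<open>n\<close>-th roots of unity;
  its inverse Fourier transform has Frobenius-invariant coefficients.\<close>

lemma orbit_reps_interpolation:
  assumes reps: "orbit_reps J \<rho>" and W: "\<And>j. j \<in> J \<Longrightarrow> W j \<in> adjoin {\<rho> j :: 'f alg_closure}"
  obtains c :: "nat \<Rightarrow> 'f" where "\<And>j. j \<in> J \<Longrightarrow> (\<Sum>i<n. to_ac (c i) * \<rho> j ^ i) = W j"
proof -
  let ?mu = "{z :: 'f alg_closure. z ^ n = 1}"
  have "\<forall>z\<in>?mu. \<exists>j k. j \<in> J \<and> z = \<rho> j ^ (q ^ k)"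
    using reps unfolding orbit_reps_def by blast
  from bchoice[OF this] obtain jj where "\<forall>z\<in>?mu. \<exists>k. jj z \<in> J \<and> z = \<rho> (jj z) ^ (q ^ k)" ..
  from bchoice[OF this] obtain kk where "\<forall>z\<in>?mu. jj z \<in> J \<and> z = \<rho> (jj z) ^ (q ^ kk z)" ..
  then have jk: "jj z \<in> J \<and> z = \<rho> (jj z) ^ (q ^ kk z)" if "z ^ n = 1" for z
    using that by blast
  have uniq: "j = j'" if "j \<in> J" "j' \<in> J" "\<rho> j ^ (q ^ k) = \<rho> j' ^ (q ^ k')" for j j' k k'
  proof -
    have "(\<rho> j ^ (q ^ k)) ^ n = (\<rho> j ^ n) ^ (q ^ k)" by (simp only: power_mult[symmetric] mult.commute)
    then have "(\<rho> j ^ (q ^ k)) ^ n = 1" using reps that(1) by (simp add: orbit_reps_def)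
    with reps have "\<exists>!i. i \<in> J \<and> (\<exists>l. \<rho> j ^ (q ^ k) = \<rho> i ^ (q ^ l))"
      unfolding orbit_reps_def by blast
    with that show ?thesis by metis
  qed
  have frob_W: "W j ^ (q ^ k) = W j ^ (q ^ l)" if "j \<in> J" "\<rho> j ^ (q ^ k) = \<rho> j ^ (q ^ l)" for j k l
    using frob_eq_on_adjoin[OF W[OF that(1)], of k l] that(2) by simp
  \<comment> \<open>The exponent \<open>kk z\<close> is an arbitrary choice, but \<open>u z\<close>
    does not depend on it: \<open>W j\<close> lies in the field generated by
    \<open>\<rho> j\<close>, so \<open>frob_W\<close> applies.\<close>
  define u where "u z = W (jj z) ^ (q ^ kk z)" for z
  have u_rep: "u (\<rho> j) = W j" if j: "j \<in> J" for j
  proof -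
    have rn: "\<rho> j ^ n = 1" using reps j by (simp add: orbit_reps_def)
    note * = jk[OF this]
    have "jj (\<rho> j) = j" using uniq[of "jj (\<rho> j)" j "kk (\<rho> j)" 0] * j by simp
    with * frob_W[OF j, of "kk (\<rho> j)" 0] show ?thesis by (simp add: u_def)
  qed
  have u_frob: "u (z ^ q) = u z ^ q" if z: "z ^ n = 1" for z
  proof -
    have "(z ^ q) ^ n = (z ^ n) ^ q" by (simp only: power_mult[symmetric] mult.commute)
    with z have zq: "(z ^ q) ^ n = 1" by simp
    have 1: "z ^ q = \<rho> (jj z) ^ (q ^ Suc (kk z))"
    proof -
      have "z ^ q = (\<rho> (jj z) ^ (q ^ kk z)) ^ q" using jk[OF z] by simp
      also have "\<dots> = \<rho> (jj z) ^ (q ^ Suc (kk z))" by (simp only: power_mult[symmetric] power_Suc2)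
      finally show ?thesis .
    qed
    have j: "jj (z ^ q) = jj z"
      using uniq[of "jj (z ^ q)" "jj z" "kk (z ^ q)" "Suc (kk z)"] jk[OF z] jk[OF zq] 1 by simp
    have "\<rho> (jj z) ^ (q ^ kk (z ^ q)) = \<rho> (jj z) ^ (q ^ Suc (kk z))"
      using 1 jk[OF zq] j by simp
    then have "u (z ^ q) = W (jj z) ^ (q ^ Suc (kk z))"
      unfolding u_def j using frob_W jk[OF z] by blast
    then show ?thesis unfolding u_def by (simp only: power_mult[symmetric] power_Suc2)
  qed
  define C where "C k = (\<Sum>z\<in>?mu. u z * inverse z ^ k) / of_nat n" for k
  have "C k \<in> range to_ac" for k
  proof -
    \<comment> \<open>Frobenius permutes the roots of unity; reindexing the sum along this
      permutation turns the \<open>q\<close>-th power of \<open>C k\<close> back into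
      \<open>C k\<close>.\<close>
    have inj: "inj_on (\<lambda>z. z ^ q) ?mu" by (rule inj_onI) (use frob_inj[of _ 1] in auto)
    have "(\<lambda>z. z ^ q) ` ?mu \<subseteq> ?mu"
    proof clarify
      fix z :: "'f alg_closure" assume "z ^ n = 1"
      moreover have "(z ^ q) ^ n = (z ^ n) ^ q" by (simp only: power_mult[symmetric] mult.commute)
      ultimately show "(z ^ q) ^ n = 1" by simp
    qed
    then have bij: "(\<lambda>z. z ^ q) ` ?mu = ?mu"
      by (rule endo_inj_surj[OF finite_roots_of_unity _ inj])
    have "(\<Sum>z\<in>?mu. u z * inverse z ^ k) ^ q = (\<Sum>z\<in>?mu. (u z * inverse z ^ k) ^ q)"
      using frob_sum[of "\<lambda>z. u z * inverse z ^ k" ?mu 1] by simp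
    also have "\<dots> = (\<Sum>z\<in>?mu. u (z ^ q) * inverse (z ^ q) ^ k)"
      by (rule sum.cong)
         (simp_all add: u_frob power_mult_distrib power_inverse mult.commute flip: power_mult)
    also have "\<dots> = (\<Sum>z\<in>(\<lambda>z. z ^ q) ` ?mu. u z * inverse z ^ k)"
      by (subst sum.reindex[OF inj]) simp
    also have "\<dots> = (\<Sum>z\<in>?mu. u z * inverse z ^ k)" by (simp only: bij)
    finally have "C k ^ q = C k"
      using frob_base[of "of_nat n" 1] by (simp add: C_def power_divide)
    then show ?thesis by (simp add: frob_fixed_iff_base)
  qed
  then have of_ac: "to_ac (of_ac (C k)) = C k" for k by (rule to_ac_of_ac)
  have "(\<Sum>k<n. C k * w ^ k) = u w" if w: "w ^ n = 1" for w
  proof -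
    have "C k * w ^ k = (\<Sum>z\<in>?mu. u z * (w / z) ^ k) / of_nat n" for k
      unfolding C_def times_divide_eq_left sum_distrib_right
      by (simp add: divide_inverse power_mult_distrib mult_ac)
    then have "(\<Sum>k<n. C k * w ^ k) = (\<Sum>k<n. \<Sum>z\<in>?mu. u z * (w / z) ^ k) / of_nat n"
      by (simp add: sum_divide_distrib)
    also have "\<dots> = (\<Sum>z\<in>?mu. u z * (\<Sum>k<n. (w / z) ^ k)) / of_nat n"
      by (subst sum.swap) (simp add: sum_distrib_left)
    \<comment> \<open>Orthogonality: for \<open>z \<noteq> w\<close> the ratio is an n-th root of
      unity other than 1, so the geometric sum vanishes; for \<open>z = w\<close> it equals
      n.\<close>
    also have "(\<Sum>z\<in>?mu. u z * (\<Sum>k<n. (w / z) ^ k)) = (\<Sum>z\<in>?mu. if z = w then u w * of_nat n else 0)"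
    proof (rule sum.cong[OF refl])
      fix z assume "z \<in> ?mu"
      then have z: "z ^ n = 1" by simp
      then have "z \<noteq> 0" using n_pos by (auto simp: zero_power)
      show "u z * (\<Sum>k<n. (w / z) ^ k) = (if z = w then u w * of_nat n else 0)"
      proof (cases "z = w")
        case False
        then have "w / z \<noteq> 1" using \<open>z \<noteq> 0\<close> by simp
        then have "(\<Sum>k<n. (w / z) ^ k) = 0"
          using geometric_sum[of "w / z" n] w z by (simp add: power_divide)
        with False show ?thesis by simp
      qed (use \<open>z \<noteq> 0\<close> in simp)
    qed
    also have "\<dots> / of_nat n = u w"
      using w finite_roots_of_unity of_nat_n_nonzero by simp
    finally show ?thesis .
  qed
  then have "(\<Sum>i<n. to_ac (of_ac (C i)) * \<rho> j ^ i) = W j" if "j \<in> J" for j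
    using that reps u_rep by (simp add: of_ac orbit_reps_def)
  then show thesis by (rule that)
qed

end

subsection \<open>Primitive roots of unity\<close>

lemma primitive_root_power_eq_1_iff:
  fixes z :: "'k::field"
  assumes "primitive_root_of_unity l z"
  shows "z ^ m = 1 \<longleftrightarrow> l dvd m"
proof -
  have l: "l > 0" "z ^ l = 1" and min: "\<And>k. 0 < k \<Longrightarrow> k < l \<Longrightarrow> z ^ k \<noteq> 1"
    using assms by (auto simp: primitive_root_of_unity_def)
  have "z ^ m = z ^ (l * (m div l) + m mod l)" by simp
  also have "\<dots> = z ^ (m mod l)" using l by (simp only: power_add power_mult power_one mult_1)
  finally have "z ^ m = 1 \<longleftrightarrow> m mod l = 0"
    using min[of "m mod l"] l(1) by (cases "m mod l = 0") auto
  then show ?thesis by (simp add: mod_eq_0_iff_dvd)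
qed

lemma primitive_root_nonzero: "primitive_root_of_unity l (z :: 'k::field) \<Longrightarrow> z \<noteq> 0"
  by (auto simp: primitive_root_of_unity_def zero_power)

lemma primitive_root_power_eq_iff:
  fixes z :: "'k::field"
  assumes z: "primitive_root_of_unity l z"
  shows "z ^ i = z ^ j \<longleftrightarrow> [i = j] (mod l)"
proof -
  have *: "z ^ i = z ^ j \<longleftrightarrow> [i = j] (mod l)" if "i \<le> j" for i j
  proof -
    have "z ^ j = z ^ i * z ^ (j - i)" using that by (simp flip: power_add)
    then have "z ^ i = z ^ j \<longleftrightarrow> z ^ (j - i) = 1"
      using primitive_root_nonzero[OF z] by auto
    also have "\<dots> \<longleftrightarrow> [j = i] (mod l)"
      using that by (simp add: primitive_root_power_eq_1_iff[OF z] cong_altdef_nat)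
    finally show ?thesis by (simp add: cong_sym_eq)
  qed
  show ?thesis
    using *[of i j] *[of j i] by (cases "i \<le> j") (auto simp: cong_sym_eq)
qed

text \<open>The first \<open>l\<close> powers of \<open>z\<close> are distinct, and x^l - 1 has no
  room for further roots.\<close>

lemma roots_of_unity_powers_of_primitive_root:
  fixes z w :: "'k::field"
  assumes z: "primitive_root_of_unity l z" and w: "w ^ l = 1"
  obtains k where "w = z ^ k"
proof -
  have l: "l > 0" using z by (simp add: primitive_root_of_unity_def)
  let ?P = "monom 1 l - 1 :: 'k poly"
  have deg: "degree ?P = l"
    unfolding diff_conv_add_uminus using l by (subst degree_add_eq_left) (auto simp: degree_monom_eq)
  then have "?P \<noteq> 0" using l by auto
  then have fin: "finite {x. poly ?P x = 0}" and le: "card {x. poly ?P x = 0} \<le> l"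
    using poly_roots_finite[of ?P] card_poly_roots_bound[of ?P] deg by auto
  have inj: "inj_on (\<lambda>k. z ^ k) {..<l}"
    by (rule inj_onI) (simp add: primitive_root_power_eq_iff[OF z] cong_def)
  have "(\<lambda>k. z ^ k) ` {..<l} \<subseteq> {x. poly ?P x = 0}"
  proof clarify
    fix k
    have "(z ^ k) ^ l = 1"
      using primitive_root_power_eq_1_iff[OF z, of "k * l"] by (simp add: power_mult)
    then show "poly ?P (z ^ k) = 0" by (simp add: poly_monom)
  qed
  moreover have "card ((\<lambda>k. z ^ k) ` {..<l}) = l" by (simp add: card_image[OF inj])
  ultimately have "(\<lambda>k. z ^ k) ` {..<l} = {x. poly ?P x = 0}"
    using fin le by (intro card_seteq) simp_all
  moreover have "w \<in> {x. poly ?P x = 0}" using w by (simp add: poly_monom)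
  ultimately show thesis using that by blast
qed

lemma primitive_root_power_primitive_iff:
  fixes z :: "'k::field"
  assumes z: "primitive_root_of_unity l z"
  shows "primitive_root_of_unity l (z ^ k) \<longleftrightarrow> coprime k l"
proof
  have l: "l > 0" using z by (simp add: primitive_root_of_unity_def)
  have eq: "(z ^ k) ^ m = 1 \<longleftrightarrow> l dvd k * m" for m
    using primitive_root_power_eq_1_iff[OF z, of "k * m"] by (simp add: power_mult)
  show "coprime k l" if prim: "primitive_root_of_unity l (z ^ k)"
  proof -
    \<comment> \<open>Raising \<open>z ^ k\<close> to the power l / g already gives 1, which is
      compatible with exact order \<open>l\<close> only for \<open>g = 1\<close>.\<close>
    define g where "g = gcd k l"
    obtain m c where k: "k = g * m" and lc: "l = g * c" unfolding g_def by (metis dvdE gcd_dvd1 gcd_dvd2)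
    have "l dvd k * c" unfolding k lc by simp
    then have "(z ^ k) ^ c = 1" by (simp add: eq)
    then have "g * c dvd 1 * c" using primitive_root_power_eq_1_iff[OF prim, of c] lc by simp
    then have "g = 1" using l unfolding dvd_mult_cancel_right lc by simp
    then show ?thesis unfolding g_def by (simp only: coprime_iff_gcd_eq_1)
  qed
  show "primitive_root_of_unity l (z ^ k)" if "coprime k l"
    unfolding primitive_root_of_unity_def eq
    using that l by (auto simp: coprime_commute coprime_dvd_mult_right_iff dest: dvd_imp_le)
qed

lemma card_primitive_roots:
  assumes z: "primitive_root_of_unity l (z :: 'k::field)"
  shows "finite {w :: 'k. primitive_root_of_unity l w}"
    and "card {w :: 'k. primitive_root_of_unity l w} = totient l"
proof -
  have l: "l > 0" using z by (simp add: primitive_root_of_unity_def)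
  have inj: "inj_on (\<lambda>k. z ^ k) (totatives l)"
  proof (rule inj_onI)
    fix i j assume ij: "i \<in> totatives l" "j \<in> totatives l" and "z ^ i = z ^ j"
    then have "i mod l = j mod l" by (simp add: primitive_root_power_eq_iff[OF z] cong_def)
    moreover have "k mod l = (if k = l then 0 else k)" if "k \<in> totatives l" for k
      using that by (auto simp: totatives_def)
    ultimately show "i = j" using ij by (auto simp: totatives_def split: if_splits)
  qed
  have "{w. primitive_root_of_unity l w} = (\<lambda>k. z ^ k) ` totatives l"
  proof
    show "(\<lambda>k. z ^ k) ` totatives l \<subseteq> {w. primitive_root_of_unity l w}"
      by (auto simp: primitive_root_power_primitive_iff[OF z] totatives_def)
    show "{w. primitive_root_of_unity l w} \<subseteq> (\<lambda>k. z ^ k) ` totatives l"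
    proof
      fix w :: 'k assume "w \<in> {w. primitive_root_of_unity l w}"
      then have w: "primitive_root_of_unity l w" by simp
      then have "w ^ l = 1" by (simp add: primitive_root_of_unity_def)
      from roots_of_unity_powers_of_primitive_root[OF z this] obtain k where k: "w = z ^ k" .
      \<comment> \<open>Totatives lie between 1 and \<open>l\<close>, so the residue 0 has to be
        represented by \<open>l\<close> itself; this happens for \<open>l = 1\<close>.\<close>
      define k' where "k' = (if k mod l = 0 then l else k mod l)"
      have "[k' = k] (mod l)" by (simp add: k'_def cong_def)
      then have k': "w = z ^ k'" unfolding k by (simp add: primitive_root_power_eq_iff[OF z] cong_sym_eq)
      with w have "coprime k' l" by (simp add: primitive_root_power_primitive_iff[OF z])
      moreover have "0 < k'" "k' \<le> l" using l by (auto simp: k'_def)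
      ultimately show "w \<in> (\<lambda>k. z ^ k) ` totatives l"
        using k' by (auto simp: totatives_def)
    qed
  qed
  then show "finite {w :: 'k. primitive_root_of_unity l w}"
    and "card {w :: 'k. primitive_root_of_unity l w} = totient l"
    using card_image[OF inj] by (simp_all add: totient_def)
qed

text \<open>Since \<open>z ^ (q ^ i)\<close> depends only on \<open>q ^ i\<close> modulo
  \<open>l\<close>, each orbit of primitive roots has exactly \<open>ord l q\<close> elements. The
  orbits partition the \<open>totient l\<close> primitive roots, so the division giving their number
  is exact.\<close>

lemma (in galois_field) primitive_root_orbit_reps:
  assumes \<theta>: "primitive_root_of_unity l (\<theta> :: 'f alg_closure)" and co: "coprime l q"
  obtains Z where "\<And>j. j < totient l div ord l q \<Longrightarrow> primitive_root_of_unity l (Z j :: 'f alg_closure)"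
    and "\<And>z. primitive_root_of_unity l z \<Longrightarrow>
      \<exists>!j. j < totient l div ord l q \<and> (\<exists>k. z = Z j ^ (q ^ k))"
proof -
  let ?Prim = "{w :: 'f alg_closure. primitive_root_of_unity l w}"
  define orb where "orb z = range (\<lambda>k. z ^ (q ^ k))" for z :: "'f alg_closure"
  let ?o = "ord l q"
  have o: "?o > 0" using co by simp
  have pow_eq: "z ^ (q ^ i) = z ^ (q ^ j) \<longleftrightarrow> [i = j] (mod ?o)" if "z \<in> ?Prim" for z i j
    using that co by (simp add: primitive_root_power_eq_iff order_divides_expdiff)
  have orb_refl: "z \<in> orb z" for z unfolding orb_def by (rule range_eqI[of _ _ 0]) simp
  have orb_Prim: "orb z \<subseteq> ?Prim" if "z \<in> ?Prim" for z
    using that co by (auto simp: orb_def primitive_root_power_primitive_iff coprime_commute)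
  have orb_sub: "orb w \<subseteq> orb z" if "w \<in> orb z" for w z
  proof
    fix u assume "u \<in> orb w"
    with that obtain i j where "w = z ^ (q ^ i)" "u = w ^ (q ^ j)" by (auto simp: orb_def)
    then have "u = z ^ (q ^ (i + j))" by (simp add: power_add power_mult)
    then show "u \<in> orb z" by (simp add: orb_def)
  qed
  have orb_eq: "orb w = orb z" if z: "z \<in> ?Prim" and w: "w \<in> orb z" for w z
  proof
    show "orb w \<subseteq> orb z" by (rule orb_sub[OF w])
    from w obtain i where i: "w = z ^ (q ^ i)" by (auto simp: orb_def)
    \<comment> \<open>The exponent \<open>i * (?o - 1)\<close> completes \<open>i\<close> to a
      multiple of the period \<open>?o\<close>, which leads from \<open>w\<close> back to
      \<open>z\<close>.\<close>
    have "w ^ (q ^ (i * (?o - 1))) = z ^ (q ^ (i + i * (?o - 1)))"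
      unfolding i by (simp add: power_add power_mult)
    also have "i + i * (?o - 1) = i * ?o" using o by (cases ?o) auto
    also have "z ^ (q ^ (i * ?o)) = z ^ (q ^ 0)" unfolding pow_eq[OF z] by (simp add: cong_def)
    finally have "z = w ^ (q ^ (i * (?o - 1)))" by simp
    then have "z \<in> orb w" unfolding orb_def by (rule range_eqI)
    then show "orb z \<subseteq> orb w" by (rule orb_sub)
  qed
  have orb_card: "card (orb z) = ?o" if z: "z \<in> ?Prim" for z
  proof -
    have "orb z = (\<lambda>k. z ^ (q ^ k)) ` {..<?o}"
    proof
      show "orb z \<subseteq> (\<lambda>k. z ^ (q ^ k)) ` {..<?o}"
      proof
        fix w assume "w \<in> orb z"
        then obtain k where "w = z ^ (q ^ k)" by (auto simp: orb_def)
        then have "w = z ^ (q ^ (k mod ?o))" by (simp add: pow_eq[OF z] cong_def)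
        then show "w \<in> (\<lambda>k. z ^ (q ^ k)) ` {..<?o}" using o by auto
      qed
    qed (auto simp: orb_def)
    moreover have "inj_on (\<lambda>k. z ^ (q ^ k)) {..<?o}"
      by (rule inj_onI) (simp add: pow_eq[OF z] cong_def)
    ultimately show ?thesis by (simp add: card_image)
  qed
  define C where "C = orb ` ?Prim"
  have Un: "\<Union>C = ?Prim" unfolding C_def using orb_refl orb_Prim by blast
  have finC: "finite C" unfolding C_def using card_primitive_roots(1)[OF \<theta>] by simp
  have "?o * card C = card (\<Union>C)"
  proof (rule card_partition[OF finC])
    show "finite (\<Union>C)" unfolding Un by (rule card_primitive_roots(1)[OF \<theta>])
    show "card c = ?o" if "c \<in> C" for c using that orb_card by (auto simp: C_def)
    show "c1 \<inter> c2 = {}" if c: "c1 \<in> C" "c2 \<in> C" "c1 \<noteq> c2" for c1 c2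
    proof (rule ccontr)
      assume "c1 \<inter> c2 \<noteq> {}"
      then obtain w where "w \<in> c1" "w \<in> c2" by blast
      with c orb_eq show False unfolding C_def by blast
    qed
  qed
  then have card_C: "card C = totient l div ?o"
    unfolding Un card_primitive_roots(2)[OF \<theta>] using o by (metis nonzero_mult_div_cancel_left neq0_conv)
  obtain h where h: "bij_betw h {0..<card C} C" using ex_bij_betw_nat_finite[OF finC] by blast
  define Z where "Z j = (SOME z. z \<in> ?Prim \<and> orb z = h j)" for j
  have Z: "Z j \<in> ?Prim" "orb (Z j) = h j" if "j < card C" for j
  proof -
    have "h j \<in> C" using that h by (auto simp: bij_betw_def)
    then have "\<exists>z. z \<in> ?Prim \<and> orb z = h j" by (auto simp: C_def)
    from someI_ex[OF this] show "Z j \<in> ?Prim" "orb (Z j) = h j" by (simp_all add: Z_def)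
  qed
  show thesis
  proof (rule that)
    show "primitive_root_of_unity l (Z j)" if "j < totient l div ?o" for j
      using Z(1)[of j] that card_C by simp
    fix z :: "'f alg_closure" assume z: "primitive_root_of_unity l z"
    have iff: "(\<exists>k. z = Z j ^ (q ^ k)) \<longleftrightarrow> h j = orb z" if j: "j < card C" for j
    proof
      assume "\<exists>k. z = Z j ^ (q ^ k)"
      then have "z \<in> orb (Z j)" by (auto simp: orb_def)
      from orb_eq[OF Z(1)[OF j] this] show "h j = orb z" using Z(2)[OF j] by simp
    next
      assume "h j = orb z"
      then have "z \<in> orb (Z j)" using Z(2)[OF j] orb_refl by simp
      then show "\<exists>k. z = Z j ^ (q ^ k)" by (auto simp: orb_def)
    qed
    have "orb z \<in> C" using z by (simp add: C_def)
    then have "orb z \<in> h ` {0..<card C}" using h by (simp add: bij_betw_def)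
    then obtain j where j: "j < card C" "h j = orb z" by auto
    show "\<exists>!j. j < totient l div ?o \<and> (\<exists>k. z = Z j ^ (q ^ k))"
      unfolding card_C[symmetric]
    proof (rule ex1I)
      show "j < card C \<and> (\<exists>k. z = Z j ^ (q ^ k))" using j iff by simp
      fix j' assume "j' < card C \<and> (\<exists>k. z = Z j' ^ (q ^ k))"
      then have "j' < card C" "h j' = h j" using j iff[of j'] by simp_all
      with j(1) h show "j' = j" by (auto simp: bij_betw_def inj_on_def)
    qed
  qed
qed

subsection \<open>Normal forms in the presented group\<close>

lemma (in group) pow_cong:
  assumes x: "x \<in> carrier G" and xn: "x [^] (n::nat) = \<one>" and ab: "[a = b] (mod n)"
  shows "x [^] a = x [^] b"
proof -
  have "x [^] c = x [^] (c mod n)" for c :: nat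
  proof -
    have "x [^] c = x [^] (n * (c div n) + c mod n)" by simp
    also have "\<dots> = (x [^] n) [^] (c div n) \<otimes> x [^] (c mod n)"
      using x by (simp only: nat_pow_pow nat_pow_mult)
    finally show ?thesis using x xn by simp
  qed
  from this[of a] this[of b] ab show ?thesis by (simp add: cong_def)
qed

lemma (in group) pow_exchange:
  assumes xy: "x \<in> carrier G" "y \<in> carrier G" and yx: "y \<otimes> x = x [^] (S::nat) \<otimes> y"
  shows "y \<otimes> x [^] (k::nat) = x [^] (S * k) \<otimes> y"
proof (induction k)
  case 0
  then show ?case using xy by simp
next
  case (Suc k)
  have "y \<otimes> x [^] Suc k = (y \<otimes> x [^] k) \<otimes> x"
    using xy by (simp add: m_assoc)
  also have "\<dots> = x [^] (S * k) \<otimes> (y \<otimes> x)"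
    unfolding Suc using xy by (simp add: m_assoc)
  also have "\<dots> = (x [^] (S * k) \<otimes> x [^] S) \<otimes> y"
    unfolding yx using xy by (simp add: m_assoc)
  also have "\<dots> = x [^] (S * Suc k) \<otimes> y"
    using xy by (simp add: nat_pow_mult add.commute)
  finally show ?case .
qed

text \<open>The state \<open>(i, b)\<close> stands for \<open>x\<^sup>i y\<^sup>b\<close>, and letters act by right multiplication.\<close>

fun letter_act :: "int \<Rightarrow> int \<times> bool \<Rightarrow> gens \<times> bool \<Rightarrow> int \<times> bool" where
  "letter_act s (i, b) (gen_x, e) = (i + (if b then s else 1) * (if e then 1 else -1), b)"
| "letter_act s (i, b) (gen_y, e) = (i, \<not> b)"

definition word_act :: "int \<Rightarrow> int \<times> bool \<Rightarrow> gens gword \<Rightarrow> int \<times> bool" where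
  "word_act s = foldl (letter_act s)"

text \<open>Exponents are kept as unreduced integers, which accommodates a negative
  \<open>s\<close>; reduction modulo \<open>n\<close> takes place only in this comparison.\<close>

definition state_cong :: "nat \<Rightarrow> int \<times> bool \<Rightarrow> int \<times> bool \<Rightarrow> bool" where
  "state_cong n p p' \<longleftrightarrow> [fst p = fst p'] (mod int n) \<and> snd p = snd p'"

lemma word_act_append: "word_act s p (u @ v) = word_act s (word_act s p u) v"
  by (simp add: word_act_def)

lemma letter_act_cong: "state_cong n p p' \<Longrightarrow> state_cong n (letter_act s p c) (letter_act s p' c)"
  by (cases p; cases p'; cases c; cases "fst c")
     (auto simp: state_cong_def intro: cong_add cong_diff)

lemma word_act_cong: "state_cong n p p' \<Longrightarrow> state_cong n (word_act s p w) (word_act s p' w)"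
  unfolding word_act_def by (induction w arbitrary: p p') (simp_all add: letter_act_cong)

lemma word_act_gen_x:
  "word_act s (i, b) (replicate k (gen_x, e)) = (i + int k * (if b then s else 1) * (if e then 1 else -1), b)"
  by (induction k arbitrary: i) (auto simp: word_act_def algebra_simps)

lemma word_act_gen_pow_x:
  "word_act s (i, b) (gen_pow gen_x k) = (i + k * (if b then s else 1), b)"
  by (cases "k \<ge> 0") (auto simp: gen_pow_def word_act_gen_x)

lemma word_act_gen_pow_y: "word_act s (i, b) (gen_pow gen_y 1) = (i, \<not> b)"
  by (simp add: gen_pow_def word_act_def)

text \<open>Words representing the same group element act alike modulo \<open>n\<close>, which is
  what will separate the normal forms. The condition on \<open>s\<close> is used for the exchange
  relation on a state without y: one side adds 1 to the exponent, the other adds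
  \<open>s * s\<close>.\<close>

lemma word_act_pres_eq:
  assumes "pres_eq (split_metacyclic_rels n s) u v" and s: "[s\<^sup>2 = 1] (mod int n)"
  shows "state_cong n (word_act s p u) (word_act s p v)"
  using assms(1)
proof (induction arbitrary: p)
  case (pres_cancel u a b v)
  have "word_act s p' [(a, b), (a, \<not> b)] = p'" for p'
    by (cases p'; cases a) (auto simp: word_act_def)
  then show ?case by (simp only: word_act_append) (simp add: state_cong_def)
next
  case (pres_rel l r u v)
  have "state_cong n (word_act s (i, b) l) (word_act s (i, b) r)" for i b
  proof -
    have y2: "gen_pow gen_y 2 = gen_pow gen_y 1 @ gen_pow gen_y 1"
      by (simp add: gen_pow_def numeral_2_eq_2)
    have "[i + 1 = i + s * s] (mod int n)"
      using s by (auto simp: power2_eq_square intro: cong_add cong_sym)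
    then show ?thesis
      using pres_rel
      by (auto simp: split_metacyclic_rels_def word_act_append word_act_gen_pow_x y2
            word_act_gen_pow_y state_cong_def cong_def) (simp_all add: word_act_def)
  qed
  then have "state_cong n (word_act s (word_act s p u) l) (word_act s (word_act s p u) r)"
    by (cases "word_act s p u") simp
  then show ?case by (simp only: word_act_append word_act_cong)
qed (simp_all add: state_cong_def cong_def)

text \<open>Moving every y to the right shows that the words x^i y^b reach all elements; that no two
  of them coincide follows from their action on the state \<open>(0, False)\<close>. The residue
  \<open>S\<close> keeps the exponents natural.\<close>

theorem presented_split_metacyclic_normal_form:
  fixes n :: nat and s :: int
  defines "P \<equiv> presented_group (split_metacyclic_rels n s)" and "S \<equiv> nat (s mod int n)"
  assumes n: "n > 0" and s: "[s\<^sup>2 = 1] (mod int n)"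
  obtains e where "bij_betw e ({..<n} \<times> UNIV) (carrier P)" and "e (0, False) = \<one>\<^bsub>P\<^esub>"
    and "\<And>p. e p \<in> carrier P"
    and "\<And>i b j c. e (i, b) \<otimes>\<^bsub>P\<^esub> e (j, c) = e ((i + (if b then S * j else j)) mod n, b \<noteq> c)"
proof -
  define R where "R = split_metacyclic_rels n s"
  interpret P: group P unfolding P_def by (rule group_presented_group)
  define cl where "cl = pres_class R"
  define x y where "x = cl [(gen_x, True)]" and "y = cl [(gen_y, True)]"
  have mult: "cl u \<otimes>\<^bsub>P\<^esub> cl v = cl (u @ v)" for u v
    unfolding P_def cl_def R_def by (rule presented_group_mult)
  have one: "\<one>\<^bsub>P\<^esub> = cl []" and carr: "carrier P = range cl"
    by (simp_all add: P_def presented_group_def R_def cl_def)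
  have cl_carr [simp]: "cl u \<in> carrier P" for u by (simp add: carr)
  have x_carr [simp]: "x \<in> carrier P" and y_carr [simp]: "y \<in> carrier P" by (simp_all add: x_def y_def)
  have cl_eq: "cl u = cl v \<longleftrightarrow> pres_eq R u v" for u v
    unfolding cl_def by (rule pres_class_eq_iff)
  have rel: "cl u = cl v" if "(u, v) \<in> R" for u v
    using pres_rel[OF that, of "[]" "[]"] by (simp add: cl_eq)
  have cl_pow: "cl [c] [^]\<^bsub>P\<^esub> k = cl (replicate k c)" for c k
    by (induction k) (simp_all add: one mult replicate_append_same)
  have inv: "cl [(a, True)] \<otimes>\<^bsub>P\<^esub> cl [(a, False)] = \<one>\<^bsub>P\<^esub>" for a
    using pres_cancel[of R "[]" a True "[]"] by (simp add: mult one cl_eq)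
  have xn: "x [^]\<^bsub>P\<^esub> n = \<one>\<^bsub>P\<^esub>"
    using rel[of "gen_pow gen_x (int n)" "[]"]
    by (simp add: x_def cl_pow one R_def split_metacyclic_rels_def gen_pow_def)
  have yy: "y \<otimes>\<^bsub>P\<^esub> y = \<one>\<^bsub>P\<^esub>"
    using rel[of "gen_pow gen_y 2" "[]"]
    by (simp add: y_def mult one R_def split_metacyclic_rels_def gen_pow_def numeral_2_eq_2)
  have y_inv: "cl [(gen_y, False)] = y"
    using inv[of gen_y] yy P.l_cancel[of y "cl [(gen_y, False)]" y] by (simp flip: y_def)
  have x_inv: "cl [(gen_x, False)] = x [^]\<^bsub>P\<^esub> (n - 1)"
  proof -
    have "x \<otimes>\<^bsub>P\<^esub> x [^]\<^bsub>P\<^esub> (n - 1) = x [^]\<^bsub>P\<^esub> n"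
      using n P.nat_pow_mult[of x 1 "n - 1"] by simp
    then show ?thesis
      using inv[of gen_x] xn P.l_cancel[of x "cl [(gen_x, False)]" "x [^]\<^bsub>P\<^esub> (n - 1)"]
      by (simp flip: x_def)
  qed
  have xs: "cl (gen_pow gen_x s) = x [^]\<^bsub>P\<^esub> S"
  proof (cases "s \<ge> 0")
    case True
    have "[nat s = S] (mod n)"
      unfolding S_def using True n by (simp add: cong_def nat_mod_distrib)
    then have "x [^]\<^bsub>P\<^esub> nat s = x [^]\<^bsub>P\<^esub> S" using P.pow_cong xn by simp
    with True show ?thesis by (simp add: gen_pow_def x_def cl_pow)
  next
    case False
    \<comment> \<open>For negative \<open>s\<close> the word \<open>gen_pow gen_x s\<close> consists
      of inverse letters, each equal to \<open>x\<close> to the power \<open>n - 1\<close>.\<close>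
    have "[int ((n - 1) * nat (- s)) = s] (mod int n)"
    proof -
      have "int ((n - 1) * nat (- s)) = s + int n * (- s)"
        using False n by (simp add: of_nat_diff algebra_simps)
      then show ?thesis by (simp only: cong_def mod_mult_self2)
    qed
    moreover have "[s = int S] (mod int n)" using n by (simp add: S_def cong_def)
    ultimately have "[(n - 1) * nat (- s) = S] (mod n)"
      unfolding cong_int_iff[symmetric] by (rule cong_trans)
    then have "x [^]\<^bsub>P\<^esub> ((n - 1) * nat (- s)) = x [^]\<^bsub>P\<^esub> S" using P.pow_cong xn by simp
    moreover have "cl (gen_pow gen_x s) = (x [^]\<^bsub>P\<^esub> (n - 1)) [^]\<^bsub>P\<^esub> nat (- s)"
      unfolding x_inv[symmetric] cl_pow using False by (simp add: gen_pow_def)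
    ultimately show ?thesis by (simp add: P.nat_pow_pow)
  qed
  \<comment> \<open>The relation gives the exchange in the opposite direction; multiplying it by
    \<open>y\<close> on both sides and cancelling the squares of \<open>y\<close> reverses
    it.\<close>
  have yx: "y \<otimes>\<^bsub>P\<^esub> x = x [^]\<^bsub>P\<^esub> S \<otimes>\<^bsub>P\<^esub> y"
  proof -
    have "x \<otimes>\<^bsub>P\<^esub> y = y \<otimes>\<^bsub>P\<^esub> x [^]\<^bsub>P\<^esub> S"
      using rel[of "gen_pow gen_x 1 @ gen_pow gen_y 1" "gen_pow gen_y 1 @ gen_pow gen_x s"]
      unfolding xs[symmetric] unfolding x_def y_def mult
      by (simp add: R_def split_metacyclic_rels_def gen_pow_def)
    then have "y \<otimes>\<^bsub>P\<^esub> (x \<otimes>\<^bsub>P\<^esub> y) \<otimes>\<^bsub>P\<^esub> y = y \<otimes>\<^bsub>P\<^esub> (y \<otimes>\<^bsub>P\<^esub> x [^]\<^bsub>P\<^esub> S) \<otimes>\<^bsub>P\<^esub> y" by simp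
    moreover have "y \<otimes>\<^bsub>P\<^esub> (x \<otimes>\<^bsub>P\<^esub> y) \<otimes>\<^bsub>P\<^esub> y = y \<otimes>\<^bsub>P\<^esub> x"
      by (simp add: P.m_assoc yy)
    moreover have "y \<otimes>\<^bsub>P\<^esub> (y \<otimes>\<^bsub>P\<^esub> x [^]\<^bsub>P\<^esub> S) \<otimes>\<^bsub>P\<^esub> y = x [^]\<^bsub>P\<^esub> S \<otimes>\<^bsub>P\<^esub> y"
      by (simp add: yy flip: P.m_assoc)
    ultimately show ?thesis by simp
  qed
  note exch = P.pow_exchange[OF x_carr y_carr yx]
  define e where "e = (\<lambda>(i :: nat, b). x [^]\<^bsub>P\<^esub> i \<otimes>\<^bsub>P\<^esub> (if b then y else \<one>\<^bsub>P\<^esub>))"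
  have e_mod: "e (i mod n, b) = e (i, b)" for i b
    using P.pow_cong[OF x_carr xn, of "i mod n" i] by (simp add: e_def)
  have e_mult: "e (i, b) \<otimes>\<^bsub>P\<^esub> e (j, c) = e (i + (if b then S * j else j), b \<noteq> c)" for i b j c
  proof (cases b)
    case True
    have "e (i, b) \<otimes>\<^bsub>P\<^esub> e (j, c)
        = x [^]\<^bsub>P\<^esub> i \<otimes>\<^bsub>P\<^esub> (y \<otimes>\<^bsub>P\<^esub> x [^]\<^bsub>P\<^esub> j) \<otimes>\<^bsub>P\<^esub> (if c then y else \<one>\<^bsub>P\<^esub>)"
      using True by (simp add: e_def P.m_assoc)
    also have "\<dots> = x [^]\<^bsub>P\<^esub> (i + S * j) \<otimes>\<^bsub>P\<^esub> (y \<otimes>\<^bsub>P\<^esub> (if c then y else \<one>\<^bsub>P\<^esub>))"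
      unfolding exch by (simp add: P.m_assoc flip: P.nat_pow_mult)
    finally show ?thesis using True by (simp add: e_def yy)
  next
    case False
    then show ?thesis by (auto simp: e_def P.m_assoc simp flip: P.nat_pow_mult)
  qed
  have e_range: "cl w \<in> range e" for w
  proof (induction w rule: rev_induct)
    case Nil
    have "cl [] = e (0, False)" by (simp add: e_def one)
    then show ?case by simp
  next
    case (snoc c w)
    then obtain i b where ib: "cl w = e (i, b)" by force
    have "\<exists>p. cl [c] = e p"
    proof (cases c)
      case (Pair a \<epsilon>)
      have "x = e (1, False)" "x [^]\<^bsub>P\<^esub> (n - 1) = e (n - 1, False)" "y = e (0, True)"
        by (simp_all add: e_def)
      then show ?thesis
        using Pair x_inv y_inv x_def y_def by (cases a; cases \<epsilon>) metis+
    qed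
    then obtain j b' where "cl [c] = e (j, b')" by force
    then have "cl (w @ [c]) = e (i, b) \<otimes>\<^bsub>P\<^esub> e (j, b')" by (simp add: ib flip: mult)
    then show ?case unfolding e_mult by simp
  qed
  have e_cl: "e (i, b) = cl (replicate i (gen_x, True) @ (if b then [(gen_y, True)] else []))" for i b
    unfolding e_def by (simp add: x_def y_def cl_pow mult one)
  have inj: "inj_on e ({..<n} \<times> UNIV)"
  proof (rule inj_onI, clarify)
    fix i b j c assume ij: "i < n" "j < n" and "e (i, b) = e (j, c)"
    then have "state_cong n
        (word_act s (0, False) (replicate i (gen_x, True) @ (if b then [(gen_y, True)] else [])))
        (word_act s (0, False) (replicate j (gen_x, True) @ (if c then [(gen_y, True)] else [])))"
      using word_act_pres_eq s unfolding e_cl cl_eq R_def by blast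
    then have "[int i = int j] (mod int n) \<and> b = c"
      unfolding word_act_append word_act_gen_x
      by (auto simp: state_cong_def word_act_def split: if_splits)
    with ij show "i = j \<and> b = c" by (simp add: cong_int_iff cong_def)
  qed
  have "e ` ({..<n} \<times> UNIV) = carrier P"
  proof
    show "e ` ({..<n} \<times> UNIV) \<subseteq> carrier P" by (auto simp: e_cl)
    show "carrier P \<subseteq> e ` ({..<n} \<times> UNIV)"
    proof
      fix g assume "g \<in> carrier P"
      then obtain i b where "g = e (i, b)" using e_range by (force simp: carr)
      then have "g = e (i mod n, b)" by (simp add: e_mod)
      then show "g \<in> e ` ({..<n} \<times> UNIV)" using n by auto
    qed
  qed
  with inj have "bij_betw e ({..<n} \<times> UNIV) (carrier P)" by (simp add: bij_betw_def)
  moreover have "e (0, False) = \<one>\<^bsub>P\<^esub>" by (simp add: e_def)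
  moreover have "e p \<in> carrier P" for p by (cases p) (simp add: e_cl)
  ultimately show thesis using that e_mult e_mod by simp
qed

subsection \<open>Algebra homomorphisms\<close>

definition alg_hom :: "('f, 'm) module \<Rightarrow> ('f, 'k) module \<Rightarrow> ('m \<Rightarrow> 'k) set" where
  "alg_hom A B = {h \<in> ring_hom A B. \<forall>c. \<forall>x\<in>carrier A. h (c \<odot>\<^bsub>A\<^esub> x) = c \<odot>\<^bsub>B\<^esub> h x}"

lemma alg_homI:
  assumes "\<And>x. x \<in> carrier A \<Longrightarrow> h x \<in> carrier B"
    and "\<And>x y. x \<in> carrier A \<Longrightarrow> y \<in> carrier A \<Longrightarrow> h (x \<otimes>\<^bsub>A\<^esub> y) = h x \<otimes>\<^bsub>B\<^esub> h y"
    and "\<And>x y. x \<in> carrier A \<Longrightarrow> y \<in> carrier A \<Longrightarrow> h (x \<oplus>\<^bsub>A\<^esub> y) = h x \<oplus>\<^bsub>B\<^esub> h y"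
    and "h \<one>\<^bsub>A\<^esub> = \<one>\<^bsub>B\<^esub>"
    and "\<And>c x. x \<in> carrier A \<Longrightarrow> h (c \<odot>\<^bsub>A\<^esub> x) = c \<odot>\<^bsub>B\<^esub> h x"
  shows "h \<in> alg_hom A B"
  using assms by (auto simp: alg_hom_def intro!: ring_hom_memI)

lemma alg_hom_closed: "h \<in> alg_hom A B \<Longrightarrow> x \<in> carrier A \<Longrightarrow> h x \<in> carrier B"
  by (auto simp: alg_hom_def dest: ring_hom_closed)

lemma alg_hom_mult:
  "h \<in> alg_hom A B \<Longrightarrow> x \<in> carrier A \<Longrightarrow> y \<in> carrier A \<Longrightarrow> h (x \<otimes>\<^bsub>A\<^esub> y) = h x \<otimes>\<^bsub>B\<^esub> h y"
  by (auto simp: alg_hom_def ring_hom_mult)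

lemma alg_hom_one: "h \<in> alg_hom A B \<Longrightarrow> h \<one>\<^bsub>A\<^esub> = \<one>\<^bsub>B\<^esub>"
  by (auto simp: alg_hom_def ring_hom_one)

lemma alg_isomorphicI: "h \<in> alg_hom A B \<Longrightarrow> bij_betw h (carrier A) (carrier B) \<Longrightarrow> A \<cong>\<^sub>a\<^sub>l\<^sub>g B"
  unfolding alg_isomorphic_def alg_hom_def ring_iso_def by blast

lemma alg_hom_direct_sum:
  assumes "\<And>i. i \<in> I \<Longrightarrow> h i \<in> alg_hom A (B i)"
  shows "(\<lambda>a. \<lambda>i\<in>I. h i a) \<in> alg_hom A (direct_sum I B)"
  using assms
  by (intro alg_homI)
     (auto simp: direct_sum_def alg_hom_def ring_hom_mult ring_hom_add ring_hom_one
           intro!: restrict_ext dest: ring_hom_closed)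

lemma alg_hom_direct_sum2:
  assumes "h \<in> alg_hom A B" and "h' \<in> alg_hom A C"
  shows "(\<lambda>a. (h a, h' a)) \<in> alg_hom A (B \<boxplus> C)"
  using assms
  by (intro alg_homI)
     (auto simp: direct_sum2_def alg_hom_def ring_hom_mult ring_hom_add ring_hom_one
           dest: ring_hom_closed)

subsection \<open>Two by two matrices\<close>

definition mat2 :: "'a \<Rightarrow> 'a \<Rightarrow> 'a \<Rightarrow> 'a \<Rightarrow> 'a ^ 2 ^ 2" where
  "mat2 a b c d = (\<chi> i j. if i = 1 then if j = 1 then a else b else if j = 1 then c else d)"

lemma mat2_entries [simp]:
  "mat2 a b c d $ 1 $ 1 = a" "mat2 a b c d $ 1 $ 2 = b"
  "mat2 a b c d $ 2 $ 1 = c" "mat2 a b c d $ 2 $ 2 = d"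
  by (simp_all add: mat2_def)

lemma mat2_eq_iff:
  "M = N \<longleftrightarrow> M $ 1 $ 1 = N $ 1 $ 1 \<and> M $ 1 $ 2 = N $ 1 $ 2 \<and> M $ 2 $ 1 = N $ 2 $ 1 \<and> M $ 2 $ 2 = N $ 2 $ 2"
  for M N :: "'a ^ 2 ^ 2"
  by (auto simp: vec_eq_iff forall_2)

lemma mat2_mult: "mat2 a b c d ** mat2 a' b' c' d'
    = mat2 (a * a' + b * c') (a * b' + b * d') (c * a' + d * c') (c * b' + d * d')"
  by (simp add: mat2_eq_iff matrix_matrix_mult_def sum_2)

lemma mat2_add: "mat2 a b c d + mat2 a' b' c' d' = mat2 (a + a') (b + b') (c + c') (d + d')"
  by (simp add: mat2_eq_iff)

lemma mat2_one: "mat 1 = mat2 1 0 0 1"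
  by (simp add: mat2_eq_iff mat_def)

lemma matrix_scale_conj:
  fixes M :: "'a::comm_ring_1 ^ 'n ^ 'n"
  shows "D ** (\<chi> i j. c * M $ i $ j) ** C = (\<chi> i j. c * (D ** M ** C) $ i $ j)"
  by (simp add: vec_eq_iff matrix_matrix_mult_def sum_distrib_left mult_ac)

lemma matrix_conj_add:
  fixes M :: "'a::comm_ring_1 ^ 'n ^ 'n"
  shows "D ** (M + N) ** C = D ** M ** C + D ** N ** C"
  by (simp add: vec_eq_iff matrix_matrix_mult_def sum.distrib algebra_simps)

text \<open>These are the coefficient pairs (\<alpha>, \<beta>) that arise when the induced
  representation is written in the basis 1, z. For each pair, \<alpha> + \<beta> and \<alpha> z +
  \<beta> w come out symmetric in z and w, which feeds
  \<open>linear_recurrence_adjoin\<close>.\<close>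

lemma difference_quotient_identities:
  fixes z w \<delta> :: "'a::field"
  assumes \<delta>: "\<delta> \<noteq> 0" and w: "w = z + \<delta>"
  shows "w / \<delta> + - z / \<delta> = 1" and "w / \<delta> * z + - z / \<delta> * w = 0"
    and "- 1 / \<delta> + 1 / \<delta> = 0" and "- 1 / \<delta> * z + 1 / \<delta> * w = 1"
    and "w * w / \<delta> + - z * z / \<delta> = z + w" and "w * w / \<delta> * z + - z * z / \<delta> * w = z * w"
    and "- z / \<delta> + w / \<delta> = 1" and "- z / \<delta> * z + w / \<delta> * w = z + w"
  using \<delta> by (simp_all add: w field_simps)

lemma mat2_basis_change:
  fixes z w \<delta> :: "'a::field"
  assumes \<delta>: "\<delta> \<noteq> 0" and w: "w = z + \<delta>"
  shows "mat2 1 z 1 w ** mat2 (w / \<delta>) (- z / \<delta>) (- 1 / \<delta>) (1 / \<delta>) = mat 1"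
    and "mat2 (w / \<delta>) (- z / \<delta>) (- 1 / \<delta>) (1 / \<delta>) ** mat2 1 z 1 w = mat 1"
  unfolding mat2_mult mat2_one mat2_eq_iff mat2_entries
  using \<delta> by (simp_all add: w field_simps)

lemma mat2_in_mat2_algebra_iff:
  "mat2 a b c d \<in> carrier (mat2_algebra K) \<longleftrightarrow> a \<in> K \<and> b \<in> K \<and> c \<in> K \<and> d \<in> K"
  by (auto simp: mat2_algebra_def forall_2)

subsection \<open>The group algebra in coordinates\<close>

text \<open>Pairing a product with a function \<open>\<psi>\<close> on the group turns convolution
  into a plain double sum. Evaluation of a coordinate polynomial at a root of unity is such a
  pairing.\<close>

lemma group_algebra_mult_sum:
  fixes a b :: "'g \<Rightarrow> 'f::field" and G (structure)
  assumes "group G" and fin: "finite (carrier G)"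
    and a: "a \<in> carrier (group_algebra G)" and b: "b \<in> carrier (group_algebra G)"
  shows "(\<Sum>g\<in>carrier G. to_ac ((a \<otimes>\<^bsub>group_algebra G\<^esub> b) g) * \<psi> g)
    = (\<Sum>h\<in>carrier G. \<Sum>k\<in>carrier G. to_ac (a h) * to_ac (b k) * \<psi> (h \<otimes> k))"
proof -
  interpret group G by fact
  let ?C = "carrier G \<times> carrier G"
  have "(a \<otimes>\<^bsub>group_algebra G\<^esub> b) g = (\<Sum>(h, k)\<in>{p \<in> ?C. fst p \<otimes> snd p = g}. a h * b k)" for g
    unfolding group_algebra_def monoid.simps
    by (rule sum.mono_neutral_left) (use a b fin in \<open>auto simp: group_algebra_def\<close>)
  then have "(\<Sum>g\<in>carrier G. to_ac ((a \<otimes>\<^bsub>group_algebra G\<^esub> b) g) * \<psi> g)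
      = (\<Sum>g\<in>carrier G. \<Sum>p\<in>{p \<in> ?C. fst p \<otimes> snd p = g}.
          to_ac (a (fst p)) * to_ac (b (snd p)) * \<psi> (fst p \<otimes> snd p))"
    by (intro sum.cong refl) (simp add: to_ac_sum sum_distrib_right case_prod_beta)
  also have "\<dots> = (\<Sum>p\<in>?C. to_ac (a (fst p)) * to_ac (b (snd p)) * \<psi> (fst p \<otimes> snd p))"
    by (rule sum.group) (use fin in auto)
  finally show ?thesis by (simp add: sum.cartesian_product case_prod_beta)
qed

text \<open>The representations see the group only through the multiplication table of its normal
  forms; words and relations are left behind.\<close>

locale metacyclic_coords = group G for G :: "('g, 'm) monoid_scheme" (structure) +
  fixes n S :: nat and e :: "nat \<times> bool \<Rightarrow> 'g"
  assumes n_pos: "n > 0" and S_square: "[S * S = 1] (mod n)"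
    and e_bij: "bij_betw e ({..<n} \<times> UNIV) (carrier G)" and e_one: "e (0, False) = \<one>"
    and e_mult: "\<And>i b j c. e (i, b) \<otimes> e (j, c) = e ((i + (if b then S * j else j)) mod n, b \<noteq> c)"
begin

text \<open>For a group algebra element p + r y with polynomials p, r in x, the flag
  \<open>False\<close> evaluates p at \<open>z\<close> and \<open>True\<close> evaluates r.\<close>

definition coord_eval :: "bool \<Rightarrow> ('g \<Rightarrow> 'f::field) \<Rightarrow> 'f alg_closure \<Rightarrow> 'f alg_closure" where
  "coord_eval b a z = (\<Sum>i<n. to_ac (a (e (i, b))) * z ^ i)"

lemma sum_carrier: "(\<Sum>g\<in>carrier G. F g) = (\<Sum>i<n. F (e (i, False))) + (\<Sum>i<n. F (e (i, True)))"
proof -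
  have "(\<Sum>g\<in>carrier G. F g) = (\<Sum>p\<in>{..<n} \<times> UNIV. F (e p))"
    by (rule sum.reindex_bij_betw[OF e_bij, symmetric])
  also have "\<dots> = (\<Sum>i<n. \<Sum>b\<in>UNIV. F (e (i, b)))"
    by (simp add: sum.cartesian_product)
  finally show ?thesis by (simp add: UNIV_bool sum.distrib)
qed

lemma finite_carrier: "finite (carrier G)"
  using e_bij bij_betw_finite by fastforce

lemma e_inj: "i < n \<Longrightarrow> j < n \<Longrightarrow> e (i, b) = e (j, c) \<longleftrightarrow> i = j \<and> b = c"
  using e_bij by (auto simp: bij_betw_def inj_on_def)

lemma power_mod: "z ^ n = 1 \<Longrightarrow> z ^ (k mod n) = (z ^ k :: 'a::field)"
proof -
  assume z: "z ^ n = 1"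
  have "z ^ k = z ^ (n * (k div n) + k mod n)" by simp
  also have "\<dots> = z ^ (k mod n)" using z by (simp only: power_add power_mult power_one mult_1)
  finally show ?thesis by simp
qed

lemma power_S_S: "z ^ n = 1 \<Longrightarrow> (z ^ S) ^ S = (z :: 'a::field)"
proof -
  assume z: "z ^ n = 1"
  have "(z ^ S) ^ S = z ^ (S * S mod n)" by (simp only: power_mod[OF z] power_mult)
  also have "\<dots> = z ^ (1 mod n)" using S_square by (simp add: cong_def)
  finally show ?thesis by (simp only: power_mod[OF z] power_one_right)
qed

lemma power_S_n: "z ^ n = 1 \<Longrightarrow> (z ^ S) ^ n = (1 :: 'a::field)"
  by (metis mult.commute power_mult power_one)

text \<open>Moving y past a power of x replaces x by x^S, hence the argument \<open>z ^ S\<close> in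
  the terms where the left factor contributes a y.\<close>

lemma coord_eval_mult:
  fixes a b :: "'g \<Rightarrow> 'f::field"
  assumes a: "a \<in> carrier (group_algebra G)" and b: "b \<in> carrier (group_algebra G)" and z: "z ^ n = 1"
  shows "coord_eval False (a \<otimes>\<^bsub>group_algebra G\<^esub> b) z
      = coord_eval False a z * coord_eval False b z + coord_eval True a z * coord_eval True b (z ^ S)"
    and "coord_eval True (a \<otimes>\<^bsub>group_algebra G\<^esub> b) z
      = coord_eval False a z * coord_eval True b z + coord_eval True a z * coord_eval False b (z ^ S)"
proof -
  define e' where "e' = inv_into ({..<n} \<times> UNIV) e"
  \<comment> \<open>\<open>\<psi> \<beta>\<close> selects the part with the given power of y and
    evaluates it at \<open>z\<close>, expressed as a function on the group.\<close>
  define \<psi> where "\<psi> \<beta> g = (if snd (e' g) = \<beta> then z ^ fst (e' g) else 0)" for \<beta> g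
  have e': "e' (e (i, c)) = (i, c)" if "i < n" for i c
    using e_bij that unfolding e'_def by (intro inv_into_f_f) (auto simp: bij_betw_def)
  have \<psi>: "\<psi> \<beta> (e (i, c)) = (if c = \<beta> then z ^ i else 0)" if "i < n" for \<beta> i c
    using that by (simp add: \<psi>_def e')
  have \<psi>_mult: "\<psi> \<beta> (e (i, c) \<otimes> e (j, c')) = (if (c \<noteq> c') = \<beta> then z ^ i * (if c then (z ^ S) ^ j else z ^ j) else 0)"
    for \<beta> i j c c'
    using n_pos by (simp add: e_mult \<psi> power_mod[OF z] power_add power_mult)
  have eval: "coord_eval \<beta> (a \<otimes>\<^bsub>group_algebra G\<^esub> b) z
      = (\<Sum>h\<in>carrier G. \<Sum>k\<in>carrier G. to_ac (a h) * to_ac (b k) * \<psi> \<beta> (h \<otimes> k))" for \<beta>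
  proof -
    have "coord_eval \<beta> (a \<otimes>\<^bsub>group_algebra G\<^esub> b) z
        = (\<Sum>g\<in>carrier G. to_ac ((a \<otimes>\<^bsub>group_algebra G\<^esub> b) g) * \<psi> \<beta> g)"
      unfolding sum_carrier coord_eval_def by (cases \<beta>) (simp_all add: \<psi>)
    then show ?thesis
      using group_algebra_mult_sum[OF group_axioms finite_carrier a b] by simp
  qed
  show "coord_eval False (a \<otimes>\<^bsub>group_algebra G\<^esub> b) z
      = coord_eval False a z * coord_eval False b z + coord_eval True a z * coord_eval True b (z ^ S)"
    unfolding eval unfolding sum_carrier coord_eval_def \<psi>_mult sum_product
    by (simp add: sum.distrib mult_ac)
  show "coord_eval True (a \<otimes>\<^bsub>group_algebra G\<^esub> b) z
      = coord_eval False a z * coord_eval True b z + coord_eval True a z * coord_eval False b (z ^ S)"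
    unfolding eval unfolding sum_carrier coord_eval_def \<psi>_mult sum_product
    by (simp add: sum.distrib mult_ac)
qed

lemma coord_eval_add:
  "coord_eval \<beta> (a \<oplus>\<^bsub>group_algebra G\<^esub> b) z = coord_eval \<beta> a z + coord_eval \<beta> b z"
  by (simp add: coord_eval_def group_algebra_def sum.distrib algebra_simps)

lemma coord_eval_smult:
  "coord_eval \<beta> (c \<odot>\<^bsub>group_algebra G\<^esub> a) z = to_ac c * coord_eval \<beta> a z"
  by (simp add: coord_eval_def group_algebra_def sum_distrib_left mult_ac)

lemma coord_eval_one: "coord_eval \<beta> \<one>\<^bsub>group_algebra G\<^esub> z = (if \<beta> then 0 else 1)"
proof -
  have "coord_eval \<beta> \<one>\<^bsub>group_algebra G\<^esub> z = (\<Sum>i<n. if i = 0 \<and> \<not> \<beta> then 1 else 0)"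
    unfolding coord_eval_def
    by (rule sum.cong) (use n_pos in \<open>auto simp: group_algebra_def e_one[symmetric] e_inj\<close>)
  then show ?thesis using n_pos by (cases \<beta>) simp_all
qed

lemma coord_eval_adjoin: "z \<in> adjoin A \<Longrightarrow> coord_eval \<beta> a z \<in> adjoin A"
  unfolding coord_eval_def by (intro adjoin_sum adjoin_mult adjoin_base adjoin_power)

section \<open>One-dimensional characters and induced two-dimensional representations\<close>

definition char_rep :: "'f::field \<Rightarrow> 'f alg_closure \<Rightarrow> ('g \<Rightarrow> 'f) \<Rightarrow> 'f alg_closure" where
  "char_rep \<sigma> z a = coord_eval False a z + to_ac \<sigma> * coord_eval True a z"

text \<open>This is the linear extension of x -> \<open>z\<close>, y -> \<open>\<sigma>\<close>: the
  condition \<open>z ^ S = z\<close> matches the exchange relation, and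
  \<open>\<sigma> * \<sigma> = 1\<close> matches y^2 = 1.\<close>

lemma char_rep_alg_hom:
  assumes z: "z ^ n = 1" "z ^ S = z" and \<sigma>: "\<sigma> * \<sigma> = 1" and K: "z \<in> adjoin A"
  shows "char_rep \<sigma> z \<in> alg_hom (group_algebra G) (field_algebra (adjoin A))"
proof (rule alg_homI)
  have \<sigma>': "to_ac \<sigma> * (to_ac \<sigma> * w) = w" for w
    using \<sigma> by (metis mult.assoc mult_1 to_ac_1 to_ac_mult)
  show "char_rep \<sigma> z a \<in> carrier (field_algebra (adjoin A))" for a
    using K by (simp add: char_rep_def field_algebra_def adjoin_closed coord_eval_adjoin)
  show "char_rep \<sigma> z (a \<otimes>\<^bsub>group_algebra G\<^esub> b)
      = char_rep \<sigma> z a \<otimes>\<^bsub>field_algebra (adjoin A)\<^esub> char_rep \<sigma> z b"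
    if "a \<in> carrier (group_algebra G)" "b \<in> carrier (group_algebra G)" for a b
    using z by (simp add: char_rep_def field_algebra_def coord_eval_mult[OF that] algebra_simps \<sigma>')
  show "char_rep \<sigma> z (a \<oplus>\<^bsub>group_algebra G\<^esub> b)
      = char_rep \<sigma> z a \<oplus>\<^bsub>field_algebra (adjoin A)\<^esub> char_rep \<sigma> z b" for a b
    by (simp add: char_rep_def field_algebra_def coord_eval_add algebra_simps)
  show "char_rep \<sigma> z \<one>\<^bsub>group_algebra G\<^esub> = \<one>\<^bsub>field_algebra (adjoin A)\<^esub>"
    by (simp add: char_rep_def field_algebra_def coord_eval_one)
  show "char_rep \<sigma> z (c \<odot>\<^bsub>group_algebra G\<^esub> a) = c \<odot>\<^bsub>field_algebra (adjoin A)\<^esub> char_rep \<sigma> z a" for c a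
    by (simp add: char_rep_def field_algebra_def coord_eval_smult algebra_simps)
qed

text \<open>Induced from the character x -> \<open>z\<close> of the cyclic subgroup: x becomes the
  diagonal matrix with entries \<open>z\<close> and \<open>z ^ S\<close>, and y the swap.\<close>

definition induced_rep :: "'f::field alg_closure \<Rightarrow> ('g \<Rightarrow> 'f) \<Rightarrow> 'f alg_closure ^ 2 ^ 2" where
  "induced_rep z a = mat2 (coord_eval False a z) (coord_eval True a z)
     (coord_eval True a (z ^ S)) (coord_eval False a (z ^ S))"

lemma induced_rep_alg_hom:
  assumes z: "z ^ n = 1" and K: "z \<in> adjoin A"
  shows "induced_rep z \<in> alg_hom (group_algebra G) (mat2_algebra (adjoin A))"
proof (rule alg_homI)
  show "induced_rep z a \<in> carrier (mat2_algebra (adjoin A))" for a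
    unfolding induced_rep_def mat2_in_mat2_algebra_iff
    using K by (simp add: coord_eval_adjoin adjoin_power)
  show "induced_rep z (a \<otimes>\<^bsub>group_algebra G\<^esub> b)
      = induced_rep z a \<otimes>\<^bsub>mat2_algebra (adjoin A)\<^esub> induced_rep z b"
    if "a \<in> carrier (group_algebra G)" "b \<in> carrier (group_algebra G)" for a b
    using z power_S_S[OF z] power_S_n[OF z]
    by (simp add: induced_rep_def mat2_algebra_def coord_eval_mult[OF that] mat2_mult)
       (simp add: add.commute)
  show "induced_rep z (a \<oplus>\<^bsub>group_algebra G\<^esub> b)
      = induced_rep z a \<oplus>\<^bsub>mat2_algebra (adjoin A)\<^esub> induced_rep z b" for a b
    by (simp add: induced_rep_def mat2_algebra_def coord_eval_add mat2_add)
  show "induced_rep z \<one>\<^bsub>group_algebra G\<^esub> = \<one>\<^bsub>mat2_algebra (adjoin A)\<^esub>"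
    by (simp add: induced_rep_def mat2_algebra_def coord_eval_one mat2_one)
  show "induced_rep z (c \<odot>\<^bsub>group_algebra G\<^esub> a) = c \<odot>\<^bsub>mat2_algebra (adjoin A)\<^esub> induced_rep z a" for c a
    by (simp add: induced_rep_def mat2_algebra_def coord_eval_smult mat2_eq_iff)
qed

text \<open>In the basis \<open>1, z\<close> of \<open>F(z)\<close> over its subfield \<open>F(z + z\<^sup>S, z\<^sup>S\<^sup>+\<^sup>1)\<close>, the induced
  representation becomes defined over that subfield.\<close>

definition basis_mat :: "'f::field alg_closure \<Rightarrow> 'f alg_closure ^ 2 ^ 2" where
  "basis_mat z = mat2 1 z 1 (z ^ S)"

definition basis_mat_inv :: "'f::field alg_closure \<Rightarrow> 'f alg_closure ^ 2 ^ 2" where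
  "basis_mat_inv z =
     mat2 (z ^ S / (z ^ S - z)) (- z / (z ^ S - z)) (- 1 / (z ^ S - z)) (1 / (z ^ S - z))"

lemma basis_mat_inverse:
  assumes "z ^ S \<noteq> z"
  shows "basis_mat z ** basis_mat_inv z = mat 1" "basis_mat_inv z ** basis_mat z = mat 1"
proof -
  have "z ^ S - z \<noteq> 0" using assms by simp
  moreover have "z ^ S = z + (z ^ S - z)" by simp
  ultimately show "basis_mat z ** basis_mat_inv z = mat 1" "basis_mat_inv z ** basis_mat z = mat 1"
    unfolding basis_mat_def basis_mat_inv_def by (rule mat2_basis_change)+
qed

definition descended_rep :: "'f::field alg_closure \<Rightarrow> ('g \<Rightarrow> 'f) \<Rightarrow> 'f alg_closure ^ 2 ^ 2" where
  "descended_rep z a = basis_mat_inv z ** induced_rep z a ** basis_mat z"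

text \<open>The sequence in \<open>i\<close> satisfies the recurrence with characteristic polynomial
  (X - z)(X - w), whose coefficients lie in the field, so its two initial terms decide.\<close>

lemma linear_recurrence_adjoin:
  fixes z w \<alpha> \<beta> :: "'f::field alg_closure"
  assumes "\<alpha> + \<beta> \<in> adjoin {z + w, z * w}" "\<alpha> * z + \<beta> * w \<in> adjoin {z + w, z * w}"
  shows "\<alpha> * z ^ i + \<beta> * w ^ i \<in> adjoin {z + w, z * w}"
proof (induction i rule: less_induct)
  case (less i)
  show ?case
  proof (cases "i < 2")
    case True
    then have "i = 0 \<or> i = 1" by auto
    then show ?thesis using assms by auto
  next
    case False
    then obtain k where i: "i = Suc (Suc k)" by (auto dest!: le_Suc_ex simp: not_less)
    have "\<alpha> * z ^ i + \<beta> * w ^ i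
        = (z + w) * (\<alpha> * z ^ Suc k + \<beta> * w ^ Suc k) - z * w * (\<alpha> * z ^ k + \<beta> * w ^ k)"
      unfolding i by (simp add: algebra_simps)
    moreover have "\<alpha> * z ^ Suc k + \<beta> * w ^ Suc k \<in> adjoin {z + w, z * w}"
      and "\<alpha> * z ^ k + \<beta> * w ^ k \<in> adjoin {z + w, z * w}"
      by (rule less.IH, simp add: i)+
    moreover have "z + w \<in> adjoin {z + w, z * w}" "z * w \<in> adjoin {z + w, z * w}"
      by (simp_all add: adjoin_gen)
    ultimately show ?thesis by (simp only: adjoin_diff adjoin_mult)
  qed
qed

lemma coord_eval_combination_adjoin:
  fixes a :: "'g \<Rightarrow> 'f::field"
  assumes "\<alpha> + \<beta> \<in> adjoin {z + z ^ S, z * z ^ S}" "\<alpha> * z + \<beta> * z ^ S \<in> adjoin {z + z ^ S, z * z ^ S}"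
  shows "\<alpha> * coord_eval b a z + \<beta> * coord_eval b a (z ^ S) \<in> adjoin {z + z ^ S, z * z ^ S}"
proof -
  have "\<alpha> * coord_eval b a z + \<beta> * coord_eval b a (z ^ S)
      = (\<Sum>i<n. to_ac (a (e (i, b))) * (\<alpha> * z ^ i + \<beta> * (z ^ S) ^ i))"
    by (simp add: coord_eval_def sum_distrib_left sum.distrib algebra_simps)
  then show ?thesis
    by (simp only:) (intro adjoin_sum adjoin_mult adjoin_base linear_recurrence_adjoin[OF assms])
qed

lemma descended_rep_alg_hom:
  assumes z: "z ^ n = 1" and ne: "z ^ S \<noteq> z"
  shows "descended_rep z \<in> alg_hom (group_algebra G) (mat2_algebra (adjoin {z + z ^ S, z * z ^ S}))"
    (is "_ \<in> alg_hom _ (mat2_algebra ?K)")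
proof (rule alg_homI)
  define \<delta> where "\<delta> = z ^ S - z"
  have ne0: "\<delta> \<noteq> 0" using ne by (simp add: \<delta>_def)
  have "z ^ S = z + \<delta>" by (simp add: \<delta>_def)
  note id = difference_quotient_identities[OF ne0 this]
  have hom: "induced_rep z \<in> alg_hom (group_algebra G) (mat2_algebra (adjoin {z}))"
    by (rule induced_rep_alg_hom[OF z adjoin_gen]) simp
  have K: "z + z ^ S \<in> ?K" "z * z ^ S \<in> ?K" by (simp_all add: adjoin_gen)
  show "descended_rep z a \<in> carrier (mat2_algebra ?K)" for a
  proof -
    note comb = coord_eval_combination_adjoin
    define U V U' V' where "U = coord_eval False a z" and "V = coord_eval True a z"
      and "U' = coord_eval False a (z ^ S)" and "V' = coord_eval True a (z ^ S)"
    have 1: "z ^ S / \<delta> * coord_eval b a z + - z / \<delta> * coord_eval b a (z ^ S) \<in> ?K" for b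
      by (rule comb) (simp_all only: id adjoin_0 adjoin_1)
    have 2: "- 1 / \<delta> * coord_eval b a z + 1 / \<delta> * coord_eval b a (z ^ S) \<in> ?K" for b
      by (rule comb) (simp_all only: id adjoin_0 adjoin_1)
    have 3: "z ^ S * z ^ S / \<delta> * coord_eval b a z + - z * z / \<delta> * coord_eval b a (z ^ S) \<in> ?K" for b
      by (rule comb) (simp_all only: id K)
    have 4: "- (z ^ S) / \<delta> * coord_eval b a z + z / \<delta> * coord_eval b a (z ^ S) \<in> ?K" for b
    proof -
      have "- (z ^ S) / \<delta> * coord_eval b a z + z / \<delta> * coord_eval b a (z ^ S)
          = - (z ^ S / \<delta> * coord_eval b a z + - z / \<delta> * coord_eval b a (z ^ S))"
        by (simp add: divide_inverse algebra_simps)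
      then show ?thesis using adjoin_uminus[OF 1[of b]] by (simp only:)
    qed
    have 5: "- z / \<delta> * coord_eval b a z + z ^ S / \<delta> * coord_eval b a (z ^ S) \<in> ?K" for b
      by (rule comb) (simp_all only: id K adjoin_1)
    \<comment> \<open>Each entry is regrouped by coordinate polynomial, so that only the
      combinations treated above occur; in the upper right entry the symmetric factor
      \<open>z * z ^ S\<close> is split off.\<close>
    have "descended_rep z a = mat2
        ((z ^ S / \<delta> * U + - z / \<delta> * U') + (z ^ S / \<delta> * V + - z / \<delta> * V'))
        (- (z * z ^ S) * (- 1 / \<delta> * U + 1 / \<delta> * U') + (z ^ S * z ^ S / \<delta> * V + - z * z / \<delta> * V'))
        ((- 1 / \<delta> * U + 1 / \<delta> * U') + (- 1 / \<delta> * V + 1 / \<delta> * V'))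
        ((- z / \<delta> * U + z ^ S / \<delta> * U') + (- (z ^ S) / \<delta> * V + z / \<delta> * V'))"
      unfolding descended_rep_def induced_rep_def basis_mat_def basis_mat_inv_def mat2_mult
        U_def V_def U'_def V'_def mat2_eq_iff mat2_entries \<delta>_def[symmetric]
      by (simp add: divide_inverse algebra_simps)
    then show ?thesis
      unfolding U_def V_def U'_def V'_def
      by (simp only: mat2_in_mat2_algebra_iff) (intro conjI adjoin_add adjoin_mult adjoin_uminus 1 2 3 4 5 K)
  qed
  show "descended_rep z (a \<otimes>\<^bsub>group_algebra G\<^esub> b)
      = descended_rep z a \<otimes>\<^bsub>mat2_algebra ?K\<^esub> descended_rep z b"
    if "a \<in> carrier (group_algebra G)" "b \<in> carrier (group_algebra G)" for a b
  proof -
    have "descended_rep z (a \<otimes>\<^bsub>group_algebra G\<^esub> b)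
        = basis_mat_inv z ** (induced_rep z a ** induced_rep z b) ** basis_mat z"
      using alg_hom_mult[OF hom that] by (simp add: descended_rep_def mat2_algebra_def)
    also have "\<dots> = basis_mat_inv z ** induced_rep z a ** (basis_mat z ** basis_mat_inv z)
        ** induced_rep z b ** basis_mat z"
      by (simp add: basis_mat_inverse[OF ne] matrix_mul_assoc)
    finally show ?thesis by (simp add: descended_rep_def mat2_algebra_def matrix_mul_assoc)
  qed
  show "descended_rep z (a \<oplus>\<^bsub>group_algebra G\<^esub> b)
      = descended_rep z a \<oplus>\<^bsub>mat2_algebra ?K\<^esub> descended_rep z b" for a b
    by (simp add: descended_rep_def induced_rep_def coord_eval_add mat2_algebra_def
        matrix_conj_add flip: mat2_add)
  show "descended_rep z \<one>\<^bsub>group_algebra G\<^esub> = \<one>\<^bsub>mat2_algebra ?K\<^esub>"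
    using alg_hom_one[OF hom] basis_mat_inverse[OF ne]
    by (simp add: descended_rep_def mat2_algebra_def)
  show "descended_rep z (c \<odot>\<^bsub>group_algebra G\<^esub> a) = c \<odot>\<^bsub>mat2_algebra ?K\<^esub> descended_rep z a" for c a
  proof -
    have "induced_rep z (c \<odot>\<^bsub>group_algebra G\<^esub> a) = (\<chi> i j. to_ac c * induced_rep z a $ i $ j)"
      by (simp add: induced_rep_def coord_eval_smult mat2_eq_iff)
    then show ?thesis by (simp add: descended_rep_def mat2_algebra_def matrix_scale_conj)
  qed
qed

lemma induced_rep_eq_descended:
  assumes "z ^ S \<noteq> z"
  shows "induced_rep z a = basis_mat z ** descended_rep z a ** basis_mat_inv z"
proof -
  have "basis_mat z ** descended_rep z a ** basis_mat_inv z
     = (basis_mat z ** basis_mat_inv z) ** induced_rep z a ** (basis_mat z ** basis_mat_inv z)"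
    by (simp only: descended_rep_def matrix_mul_assoc)
  then show ?thesis by (simp add: basis_mat_inverse[OF assms])
qed

end

subsection \<open>The decomposition\<close>

context coprime_galois_field
begin

text \<open>The given Frobenius power fixes the entries of \<open>N\<close>, exchanges the rows of
  the left factor and the columns of the right one, and therefore exchanges both in
  \<open>M\<close>. Surjectivity relies on it: undoing the basis change on an arbitrary target
  matrix must produce a matrix of the shape \<open>induced_rep\<close>.\<close>

lemma basis_change_frob_symmetric:
  fixes z w :: "'f alg_closure" and N :: "'f alg_closure ^ 2 ^ 2"
  defines "M \<equiv> mat2 1 z 1 w ** N ** mat2 (w / (w - z)) (- z / (w - z)) (- 1 / (w - z)) (1 / (w - z))"
  assumes N: "N \<in> carrier (mat2_algebra (adjoin {z + w, z * w}))"
    and zw: "z ^ (q ^ k) = w" and wz: "w ^ (q ^ k) = z"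
  shows "M $ 2 $ 2 = (M $ 1 $ 1) ^ (q ^ k)" and "M $ 2 $ 1 = (M $ 1 $ 2) ^ (q ^ k)"
proof -
  define Q where "Q = q ^ k"
  have fixed: "v ^ Q = v" if v: "v \<in> adjoin {z + w, z * w}" for v
  proof -
    have "u ^ (q ^ k) = u ^ (q ^ 0)" if "u \<in> {z + w, z * w}" for u
      using that
    proof
      assume "u = z + w"
      then have "u ^ (q ^ k) = w + z" by (simp only: frob_add zw wz)
      then show ?thesis using \<open>u = z + w\<close> by simp
    next
      assume "u \<in> {z * w}"
      then have "u = z * w" by simp
      then have "u ^ (q ^ k) = w * z" by (simp only: power_mult_distrib zw wz)
      then show ?thesis using \<open>u = z * w\<close> by simp
    qed
    from frob_eq_on_adjoin[OF v this] show ?thesis by (simp add: Q_def)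
  qed
  have NQ: "(N $ i $ j) ^ Q = N $ i $ j" for i j
    using N by (intro fixed) (simp add: mat2_algebra_def)
  have add: "(u + v) ^ Q = u ^ Q + v ^ Q" and diff: "(u - v) ^ Q = u ^ Q - v ^ Q"
    and um: "(- u) ^ Q = - (u ^ Q)" for u v :: "'f alg_closure"
    unfolding Q_def by (rule frob_add frob_diff frob_uminus)+
  have z: "z ^ Q = w" and w: "w ^ Q = z" using zw wz by (simp_all add: Q_def)
  have N_eq: "N = mat2 (N $ 1 $ 1) (N $ 1 $ 2) (N $ 2 $ 1) (N $ 2 $ 2)" by (simp add: mat2_eq_iff)
  have M: "M = mat2
      ((N $ 1 $ 1 + z * N $ 2 $ 1) * (w / (w - z)) + (N $ 1 $ 2 + z * N $ 2 $ 2) * (- 1 / (w - z)))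
      ((N $ 1 $ 1 + z * N $ 2 $ 1) * (- z / (w - z)) + (N $ 1 $ 2 + z * N $ 2 $ 2) * (1 / (w - z)))
      ((N $ 1 $ 1 + w * N $ 2 $ 1) * (w / (w - z)) + (N $ 1 $ 2 + w * N $ 2 $ 2) * (- 1 / (w - z)))
      ((N $ 1 $ 1 + w * N $ 2 $ 1) * (- z / (w - z)) + (N $ 1 $ 2 + w * N $ 2 $ 2) * (1 / (w - z)))"
    unfolding M_def by (subst N_eq) (simp add: mat2_mult)
  have neg: "u / (z - w) = - u / (w - z)" for u
    using divide_minus_right[of u "w - z"] by simp
  show "M $ 2 $ 2 = (M $ 1 $ 1) ^ (q ^ k)"
    unfolding M mat2_entries Q_def[symmetric] add diff um power_mult_distrib power_divide NQ z w neg power_one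
    by simp
  show "M $ 2 $ 1 = (M $ 1 $ 2) ^ (q ^ k)"
    unfolding M mat2_entries Q_def[symmetric] add diff um power_mult_distrib power_divide NQ z w neg power_one
    by simp
qed

text \<open>The three blocks of indices reflect how z -> z^S acts on Frobenius orbits: fixing the
  orbit pointwise, moving points within the orbit, or exchanging it with another one. An orbit of
  the first kind yields two fields, one of the second kind a matrix algebra, and in the last block
  two orbits share one matrix algebra.\<close>

lemma group_algebra_decomposition:
  fixes G :: "('g, 'm) monoid_scheme"
    and \<theta> \<xi> :: "nat \<Rightarrow> 'f alg_closure" and Z :: "nat \<Rightarrow> nat \<Rightarrow> 'f alg_closure" and c :: "nat \<Rightarrow> nat"
  assumes coords: "metacyclic_coords G n S e" and odd_q: "odd q"
    and reps: "orbit_reps ((SIGMA l:L. {..<c l}) <+> IA <+> IB \<times> UNIV)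
      (case_sum (\<lambda>(l, j). Z l j) (case_sum \<xi> (\<lambda>(i, b). if b then \<xi> i ^ S else \<xi> i)))"
    and Z_fix: "\<And>l j. l \<in> L \<Longrightarrow> j < c l \<Longrightarrow> Z l j ^ S = Z l j"
    and Z_adjoin: "\<And>l j. l \<in> L \<Longrightarrow> j < c l \<Longrightarrow> adjoin {Z l j} = adjoin {\<theta> l}"
    and IA_moved: "\<And>i. i \<in> IA \<Longrightarrow> \<xi> i ^ S \<noteq> \<xi> i"
    and IA_conj: "\<And>i. i \<in> IA \<Longrightarrow> \<exists>k. \<xi> i ^ S = \<xi> i ^ (q ^ k)"
  shows "group_algebra G \<cong>\<^sub>a\<^sub>l\<^sub>g
      direct_sum L (\<lambda>l. copies (2 * c l) (field_algebra (adjoin {\<theta> l})))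
    \<boxplus> direct_sum IA (\<lambda>i. mat2_algebra (adjoin {\<xi> i + \<xi> i ^ S, \<xi> i * \<xi> i ^ S}))
    \<boxplus> direct_sum IB (\<lambda>i. mat2_algebra (adjoin {\<xi> i}))"
    (is "?A \<cong>\<^sub>a\<^sub>l\<^sub>g ?B1 \<boxplus> ?B2 \<boxplus> ?B3")
proof -
  interpret M: metacyclic_coords G n S e by (rule coords)
  let ?J = "(SIGMA l:L. {..<c l}) <+> IA <+> IB \<times> (UNIV :: bool set)"
  let ?\<rho> = "case_sum (\<lambda>(l, j). Z l j) (case_sum \<xi> (\<lambda>(i, b). if b then \<xi> i ^ S else \<xi> i))"
  have Z_n: "Z l j ^ n = 1" if "l \<in> L" "j < c l" for l j
  proof -
    have "Inl (l, j) \<in> ?J" using that by auto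
    with reps have "?\<rho> (Inl (l, j)) ^ n = 1" unfolding orbit_reps_def by blast
    then show ?thesis by simp
  qed
  have \<xi>A_n: "\<xi> i ^ n = 1" if "i \<in> IA" for i
  proof -
    have "Inr (Inl i) \<in> ?J" using that by auto
    with reps have "?\<rho> (Inr (Inl i)) ^ n = 1" unfolding orbit_reps_def by blast
    then show ?thesis by simp
  qed
  have \<xi>B_n: "\<xi> i ^ n = 1" if "i \<in> IB" for i
  proof -
    have "Inr (Inr (i, False)) \<in> ?J" using that by auto
    with reps have "?\<rho> (Inr (Inr (i, False))) ^ n = 1" unfolding orbit_reps_def by blast
    then show ?thesis by simp
  qed
  have two: "(2 :: 'f alg_closure) \<noteq> 0"
  proof
    assume "(2 :: 'f alg_closure) = 0"
    then have "of_nat 2 = (0 :: 'f alg_closure)" by simp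
    then have "CHAR('f) dvd 2" unfolding of_nat_eq_0_iff_char_dvd by simp
    moreover have "prime CHAR('f)" by (rule prime_CHAR_semidom) (rule CHAR_pos)
    ultimately have "CHAR('f) = 2" using primes_dvd_imp_eq two_is_prime_nat by blast
    then show False using CHAR_dvd_CARD[where 'a = 'f] card_base odd_q by simp
  qed

  \<comment> \<open>The first \<open>c l\<close> copies carry the characters with y sent to 1, the
    other \<open>c l\<close> those with y sent to -1.\<close>
  define h1 where "h1 l j = (if j < c l then M.char_rep 1 (Z l j) else M.char_rep (- 1) (Z l (j - c l)))" for l j
  define h where "h a = ((\<lambda>l\<in>L. \<lambda>j\<in>{..<2 * c l}. h1 l j a),
      (\<lambda>i\<in>IA. M.descended_rep (\<xi> i) a), (\<lambda>i\<in>IB. M.induced_rep (\<xi> i) a))" for a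
  have h1_hom: "h1 l j \<in> alg_hom ?A (field_algebra (adjoin {\<theta> l}))" if "l \<in> L" "j < 2 * c l" for l j
  proof (cases "j < c l")
    case True
    have "Z l j \<in> adjoin {Z l j}" by (rule adjoin_gen) simp
    with True that show ?thesis
      unfolding h1_def by (auto intro!: M.char_rep_alg_hom Z_n Z_fix simp: Z_adjoin)
  next
    case False
    then have j: "j - c l < c l" using that by simp
    have "Z l (j - c l) \<in> adjoin {Z l (j - c l)}" by (rule adjoin_gen) simp
    with False that j show ?thesis
      unfolding h1_def by (auto intro!: M.char_rep_alg_hom Z_n Z_fix simp: Z_adjoin)
  qed
  have h_hom: "h \<in> alg_hom ?A (?B1 \<boxplus> ?B2 \<boxplus> ?B3)"
    unfolding h_def copies_def
    by (intro alg_hom_direct_sum2 alg_hom_direct_sum h1_hom M.descended_rep_alg_hom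
          M.induced_rep_alg_hom \<xi>A_n \<xi>B_n IA_moved adjoin_gen) auto

  have inj: "inj_on h (carrier ?A)"
  proof (rule inj_onI)
    fix a b assume a: "a \<in> carrier ?A" and b: "b \<in> carrier ?A" and "h a = h b"
    then have eq1: "(\<lambda>l\<in>L. \<lambda>j\<in>{..<2 * c l}. h1 l j a) = (\<lambda>l\<in>L. \<lambda>j\<in>{..<2 * c l}. h1 l j b)"
      and eq2: "(\<lambda>i\<in>IA. M.descended_rep (\<xi> i) a) = (\<lambda>i\<in>IA. M.descended_rep (\<xi> i) b)"
      and eq3: "(\<lambda>i\<in>IB. M.induced_rep (\<xi> i) a) = (\<lambda>i\<in>IB. M.induced_rep (\<xi> i) b)"
      unfolding h_def by (simp_all only: prod.inject)
    have h1: "h1 l j a = h1 l j b" if "l \<in> L" "j < 2 * c l" for l j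
      using fun_cong[OF fun_cong[OF eq1, of l], of j] that by simp
    have h2: "M.descended_rep (\<xi> i) a = M.descended_rep (\<xi> i) b" if "i \<in> IA" for i
      using fun_cong[OF eq2, of i] that by simp
    have h3: "M.induced_rep (\<xi> i) a = M.induced_rep (\<xi> i) b" if "i \<in> IB" for i
      using fun_cong[OF eq3, of i] that by simp
    have eval: "M.coord_eval \<beta> a (?\<rho> j) = M.coord_eval \<beta> b (?\<rho> j)" if "j \<in> ?J" for \<beta> j
      using that
    proof (elim PlusE)
      fix p assume "p \<in> (SIGMA l:L. {..<c l})" and j: "j = Inl p"
      then obtain l m where p: "p = (l, m)" "l \<in> L" "m < c l" by auto
      define z where "z = Z l m"
      let ?U = "M.coord_eval False" and ?V = "M.coord_eval True"
      have 1: "?U a z + ?V a z = ?U b z + ?V b z"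
        using h1[OF p(2), of m] p by (simp add: h1_def M.char_rep_def z_def)
      have 2: "?U a z - ?V a z = ?U b z - ?V b z"
        using h1[OF p(2), of "m + c l"] p by (simp add: h1_def M.char_rep_def z_def)
      \<comment> \<open>Adding the two characters leaves twice the first coordinate, and 2 is
        invertible because \<open>q\<close> is odd.\<close>
      have "(?U a z + ?V a z) + (?U a z - ?V a z) = (?U b z + ?V b z) + (?U b z - ?V b z)"
        unfolding 1 2 ..
      then have "2 * ?U a z = 2 * ?U b z" by simp
      then have "?U a z = ?U b z" using two by simp
      with 1 show ?thesis unfolding j p by (cases \<beta>) (simp_all add: z_def)
    next
      fix y i assume "j = Inr y" "y = Inl i" "i \<in> IA"
      then have "M.induced_rep (\<xi> i) a = M.induced_rep (\<xi> i) b" and j: "?\<rho> j = \<xi> i"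
        by (simp_all add: M.induced_rep_eq_descended IA_moved h2)
      from this(1) show ?thesis unfolding j by (cases \<beta>) (simp_all add: M.induced_rep_def mat2_eq_iff)
    next
      fix y p assume jy: "j = Inr y" "y = Inr p" and "p \<in> IB \<times> (UNIV :: bool set)"
      then obtain i \<gamma> where p: "p = (i, \<gamma>)" "i \<in> IB" by auto
      from h3[OF p(2)] show ?thesis
        unfolding jy p by (cases \<beta>; cases \<gamma>) (simp_all add: M.induced_rep_def mat2_eq_iff)
    qed
    have coeff: "a (e (i, \<beta>)) = b (e (i, \<beta>))" if "i < n" for i \<beta>
    proof -
      have "(\<Sum>i<n. to_ac (a (e (i, \<beta>)) - b (e (i, \<beta>))) * ?\<rho> j ^ i) = 0" if "j \<in> ?J" for j
        using eval[OF that, of \<beta>]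
        by (simp only: M.coord_eval_def to_ac_diff left_diff_distrib sum_subtractf) simp
      from orbit_reps_eval_unique[OF reps this \<open>i < n\<close>] show ?thesis by simp
    qed
    show "a = b"
    proof
      fix g
      show "a g = b g"
      proof (cases "g \<in> carrier G")
        case True
        then have "g \<in> e ` ({..<n} \<times> UNIV)" using M.e_bij by (simp add: bij_betw_def)
        then show ?thesis using coeff by auto
      next
        case False
        with a b have "a g = 0" "b g = 0" by (auto simp: group_algebra_def)
        then show ?thesis by simp
      qed
    qed
  qed

  have surj: "T \<in> h ` carrier ?A" if T: "T \<in> carrier (?B1 \<boxplus> ?B2 \<boxplus> ?B3)" for T
  proof -
    obtain T1 T2 T3 where T_eq: "T = (T1, T2, T3)" by (metis prod.exhaust)
    have T1: "T1 \<in> (\<Pi>\<^sub>E l\<in>L. \<Pi>\<^sub>E j\<in>{..<2 * c l}. adjoin {\<theta> l})"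
      and T2: "T2 \<in> (\<Pi>\<^sub>E i\<in>IA. carrier (mat2_algebra (adjoin {\<xi> i + \<xi> i ^ S, \<xi> i * \<xi> i ^ S})))"
      and T3: "T3 \<in> (\<Pi>\<^sub>E i\<in>IB. carrier (mat2_algebra (adjoin {\<xi> i})))"
      using T unfolding T_eq by (simp_all add: direct_sum2_def direct_sum_def copies_def field_algebra_def)
    \<comment> \<open>\<open>N i\<close> is the matrix that \<open>induced_rep\<close> has to take
      for \<open>descended_rep\<close> to hit \<open>T2 i\<close>. \<open>W\<close> prescribes only
      its top row; the bottom row will follow from Frobenius symmetry.\<close>
    define N where "N i = M.basis_mat (\<xi> i) ** T2 i ** M.basis_mat_inv (\<xi> i)" for i
    define W where "W \<beta> = case_sum
      (\<lambda>(l, j). if \<beta> then (T1 l j - T1 l (j + c l)) / 2 else (T1 l j + T1 l (j + c l)) / 2)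
      (case_sum (\<lambda>i. if \<beta> then N i $ 1 $ 2 else N i $ 1 $ 1)
        (\<lambda>(i, b). if \<beta> then if b then T3 i $ 2 $ 1 else T3 i $ 1 $ 2
                  else if b then T3 i $ 2 $ 2 else T3 i $ 1 $ 1))" for \<beta>
    have W: "W \<beta> j \<in> adjoin {?\<rho> j}" if "j \<in> ?J" for \<beta> j
      using that
    proof (elim PlusE)
      fix p assume "p \<in> (SIGMA l:L. {..<c l})" and j: "j = Inl p"
      then obtain l m where p: "p = (l, m)" "l \<in> L" "m < c l" by auto
      have "T1 l m \<in> adjoin {\<theta> l}" "T1 l (m + c l) \<in> adjoin {\<theta> l}"
        using T1 p(2,3) by (auto simp: PiE_iff)
      moreover have "2 \<in> adjoin {\<theta> l}" using adjoin_base[of 2 "{\<theta> l}"] by simp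
      ultimately show ?thesis
        unfolding j p using Z_adjoin[OF p(2,3)] by (simp add: W_def adjoin_closed)
    next
      fix y i assume jy: "j = Inr y" "y = Inl i" and i: "i \<in> IA"
      let ?K = "adjoin {\<xi> i}"
      have \<xi>: "\<xi> i \<in> ?K" by (rule adjoin_gen) simp
      have "adjoin {\<xi> i + \<xi> i ^ S, \<xi> i * \<xi> i ^ S} \<subseteq> ?K"
        by (rule adjoin_subset) (use \<xi> in \<open>simp add: adjoin_closed\<close>)
      then have "T2 i $ r $ s \<in> ?K" for r s using T2 i by (auto simp: PiE_iff mat2_algebra_def)
      then have "N i $ r $ s \<in> ?K" for r s
        using \<xi> exhaust_2[of r] exhaust_2[of s]
        unfolding N_def M.basis_mat_def M.basis_mat_inv_def matrix_matrix_mult_def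
        by (auto simp: sum_2 intro!: adjoin_closed)
      then show ?thesis unfolding jy by (simp add: W_def)
    next
      fix y p assume jy: "j = Inr y" "y = Inr p" and "p \<in> IB \<times> (UNIV :: bool set)"
      then obtain i \<gamma> where p: "p = (i, \<gamma>)" "i \<in> IB" by auto
      \<comment> \<open>Interpolation at \<open>\<xi> i ^ S\<close> asks for values in the field
        generated by that root, which is the same field.\<close>
      have "adjoin {\<xi> i} = adjoin {\<xi> i ^ S}"
        by (rule adjoin_singleton_powers_eq[OF refl M.power_S_S[OF \<xi>B_n[OF p(2)], symmetric]])
      moreover have "T3 i $ r $ s \<in> adjoin {\<xi> i}" for r s
        using T3 p(2) by (auto simp: PiE_iff mat2_algebra_def)
      ultimately show ?thesis unfolding jy p by (simp add: W_def)
    qed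
    have "\<forall>\<beta>. \<exists>f :: nat \<Rightarrow> 'f. \<forall>j\<in>?J. (\<Sum>i<n. to_ac (f i) * ?\<rho> j ^ i) = W \<beta> j"
    proof
      fix \<beta>
      show "\<exists>f :: nat \<Rightarrow> 'f. \<forall>j\<in>?J. (\<Sum>i<n. to_ac (f i) * ?\<rho> j ^ i) = W \<beta> j"
      proof (rule orbit_reps_interpolation[where W = "W \<beta>", OF reps W])
        fix g :: "nat \<Rightarrow> 'f" assume "\<And>j. j \<in> ?J \<Longrightarrow> (\<Sum>i<n. to_ac (g i) * ?\<rho> j ^ i) = W \<beta> j"
        then show ?thesis by (intro exI[of _ g] ballI)
      qed
    qed
    from choice[OF this] obtain f :: "bool \<Rightarrow> nat \<Rightarrow> 'f"
      where "\<forall>\<beta>. \<forall>j\<in>?J. (\<Sum>i<n. to_ac (f \<beta> i) * ?\<rho> j ^ i) = W \<beta> j" ..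
    then have f: "(\<Sum>i<n. to_ac (f \<beta> i) * ?\<rho> j ^ i) = W \<beta> j" if "j \<in> ?J" for \<beta> j
      using that by blast
    define e' where "e' = inv_into ({..<n} \<times> UNIV) e"
    define a where "a g = (if g \<in> carrier G then f (snd (e' g)) (fst (e' g)) else 0)" for g
    have a_e: "a (e (i, \<beta>)) = f \<beta> i" if "i < n" for i \<beta>
    proof -
      have "e (i, \<beta>) \<in> carrier G" using M.e_bij that by (auto simp: bij_betw_def)
      moreover have "e' (e (i, \<beta>)) = (i, \<beta>)"
        unfolding e'_def using M.e_bij that by (intro inv_into_f_f) (auto simp: bij_betw_def)
      ultimately show ?thesis by (simp add: a_def)
    qed
    have a: "a \<in> carrier ?A"
    proof -
      have "{g. a g \<noteq> 0} \<subseteq> carrier G" by (auto simp: a_def)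
      with M.finite_carrier show ?thesis by (auto simp: group_algebra_def intro: finite_subset)
    qed
    have eval: "M.coord_eval \<beta> a (?\<rho> j) = W \<beta> j" if "j \<in> ?J" for \<beta> j
      unfolding M.coord_eval_def f[OF that, symmetric] by (rule sum.cong) (simp_all add: a_e)
    have eval_frob: "M.coord_eval \<beta> a (z ^ (q ^ k)) = M.coord_eval \<beta> a z ^ (q ^ k)" for \<beta> z k
      unfolding M.coord_eval_def by (rule frob_eval)
    have half: "(x + y) / 2 + (x - y) / 2 = x" "(x + y) / 2 - (x - y) / 2 = y" for x y :: "'f alg_closure"
      using two by (simp_all add: field_simps)
    have "(\<lambda>l\<in>L. \<lambda>j\<in>{..<2 * c l}. h1 l j a) = T1"
    proof (rule PiE_ext[OF _ T1])
      show rest: "(\<lambda>l\<in>L. \<lambda>j\<in>{..<2 * c l}. h1 l j a) \<in> (\<Pi>\<^sub>E l\<in>L. \<Pi>\<^sub>E j\<in>{..<2 * c l}. adjoin {\<theta> l})"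
        using alg_hom_closed[OF h1_hom a] by (auto simp: PiE_iff field_algebra_def)
      fix l assume l: "l \<in> L"
      have "(\<lambda>j\<in>{..<2 * c l}. h1 l j a) = T1 l"
      proof (rule PiE_ext[of _ "{..<2 * c l}" "\<lambda>_. adjoin {\<theta> l}"])
        show "(\<lambda>j\<in>{..<2 * c l}. h1 l j a) \<in> (\<Pi>\<^sub>E j\<in>{..<2 * c l}. adjoin {\<theta> l})"
          using rest l by (auto simp: PiE_iff)
        show "T1 l \<in> (\<Pi>\<^sub>E j\<in>{..<2 * c l}. adjoin {\<theta> l})" using T1 l by (auto simp: PiE_iff)
        fix j assume "j \<in> {..<2 * c l}"
        then have j: "j < 2 * c l" by simp
        show "(\<lambda>j\<in>{..<2 * c l}. h1 l j a) j = T1 l j"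
        proof (cases "j < c l")
          case True
          then have J: "Inl (l, j) \<in> ?J" using l by auto
          have "M.coord_eval False a (Z l j) + M.coord_eval True a (Z l j) = T1 l j"
            using eval[OF J, of False] eval[OF J, of True]
            by (simp only: W_def sum.case prod.case if_True if_False half)
          with j True show ?thesis by (simp add: h1_def M.char_rep_def)
        next
          case False
          then have J: "Inl (l, j - c l) \<in> ?J" using l j by auto
          have "M.coord_eval False a (Z l (j - c l)) - M.coord_eval True a (Z l (j - c l))
              = T1 l (j - c l + c l)"
            using eval[OF J, of False] eval[OF J, of True]
            by (simp only: W_def sum.case prod.case if_True if_False half)
          with j False show ?thesis by (simp add: h1_def M.char_rep_def)
        qed
      qed
      with l show "(\<lambda>l\<in>L. \<lambda>j\<in>{..<2 * c l}. h1 l j a) l = T1 l" by simp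
    qed
    moreover have "(\<lambda>i\<in>IA. M.descended_rep (\<xi> i) a) = T2"
    proof
      fix i
      show "(\<lambda>i\<in>IA. M.descended_rep (\<xi> i) a) i = T2 i"
      proof (cases "i \<in> IA")
        case True
        then have J: "Inr (Inl i) \<in> ?J" by auto
        obtain k where k: "\<xi> i ^ S = \<xi> i ^ (q ^ k)" using IA_conj[OF True] by blast
        \<comment> \<open>The conjugation that agrees with the \<open>S\<close>-th power at
          \<open>\<xi> i\<close> agrees with it at every power of \<open>\<xi> i\<close> too, so it
          swaps the two roots.\<close>
        have "(\<xi> i ^ S) ^ (q ^ k) = (\<xi> i ^ S) ^ S"
          by (metis k mult.commute power_mult)
        then have k': "(\<xi> i ^ S) ^ (q ^ k) = \<xi> i" using M.power_S_S[OF \<xi>A_n[OF True]] by simp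
        have "T2 i \<in> carrier (mat2_algebra (adjoin {\<xi> i + \<xi> i ^ S, \<xi> i * \<xi> i ^ S}))"
          using T2 True by (auto simp: PiE_iff)
        from basis_change_frob_symmetric[OF this k[symmetric] k']
        have sym: "N i $ 2 $ 2 = (N i $ 1 $ 1) ^ (q ^ k)" "N i $ 2 $ 1 = (N i $ 1 $ 2) ^ (q ^ k)"
          unfolding N_def M.basis_mat_def M.basis_mat_inv_def .
        have UV: "M.coord_eval False a (\<xi> i) = N i $ 1 $ 1" "M.coord_eval True a (\<xi> i) = N i $ 1 $ 2"
          using eval[OF J, of False] eval[OF J, of True] by (simp_all add: W_def)
        have "M.induced_rep (\<xi> i) a = N i"
          by (simp add: M.induced_rep_def mat2_eq_iff UV k eval_frob sym)
        then have "M.descended_rep (\<xi> i) a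
            = (M.basis_mat_inv (\<xi> i) ** M.basis_mat (\<xi> i)) ** T2 i ** (M.basis_mat_inv (\<xi> i) ** M.basis_mat (\<xi> i))"
          by (simp only: M.descended_rep_def N_def matrix_mul_assoc)
        with True show ?thesis by (simp add: M.basis_mat_inverse IA_moved)
      next
        case False
        with T2 show ?thesis by (auto simp: PiE_iff extensional_def)
      qed
    qed
    moreover have "(\<lambda>i\<in>IB. M.induced_rep (\<xi> i) a) = T3"
    proof
      fix i
      show "(\<lambda>i\<in>IB. M.induced_rep (\<xi> i) a) i = T3 i"
      proof (cases "i \<in> IB")
        case True
        then have J: "Inr (Inr (i, b)) \<in> ?J" for b by auto
        show ?thesis
          using True eval[OF J[of False], of False] eval[OF J[of False], of True]
            eval[OF J[of True], of False] eval[OF J[of True], of True]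
          by (simp add: W_def M.induced_rep_def mat2_eq_iff)
      next
        case False
        with T3 show ?thesis by (auto simp: PiE_iff extensional_def)
      qed
    qed
    ultimately have "h a = T" by (simp add: h_def T_eq)
    with a show ?thesis by blast
  qed
  have "h ` carrier ?A = carrier (?B1 \<boxplus> ?B2 \<boxplus> ?B3)"
    using surj alg_hom_closed[OF h_hom] by blast
  with inj have "bij_betw h (carrier ?A) (carrier (?B1 \<boxplus> ?B2 \<boxplus> ?B3))" by (simp add: bij_betw_def)
  with h_hom show ?thesis by (rule alg_isomorphicI)
qed

end

section \<open>Coordinates from the presentation and orbit representatives from the
  factorization\<close>

lemma direct_sum_cong: "(\<And>i. i \<in> I \<Longrightarrow> A i = B i) \<Longrightarrow> direct_sum I A = direct_sum I B"
  by (auto simp: direct_sum_def fun_eq_iff restrict_def intro!: PiE_cong)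

lemma metacyclic_coords_of_presentation:
  fixes G :: "('g, 'm) monoid_scheme"
  assumes G: "group G" and iso: "G \<cong> presented_group (split_metacyclic_rels n s)"
    and n: "n > 0" and s: "[s\<^sup>2 = 1] (mod int n)"
  obtains e where "metacyclic_coords G n (nat (s mod int n)) e"
proof -
  define P where "P = presented_group (split_metacyclic_rels n s)"
  define S where "S = nat (s mod int n)"
  interpret G: group G by (rule G)
  from presented_split_metacyclic_normal_form[OF n s] obtain e
    where e: "bij_betw e ({..<n} \<times> UNIV) (carrier P)" "e (0, False) = \<one>\<^bsub>P\<^esub>"
    and e_carr: "\<And>p. e p \<in> carrier P"
    and e_mult: "\<And>i b j c. e (i, b) \<otimes>\<^bsub>P\<^esub> e (j, c) = e ((i + (if b then S * j else j)) mod n, b \<noteq> c)"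
    unfolding P_def S_def by blast
  have grpP: "group P" unfolding P_def by (rule group_presented_group)
  have "P \<cong> G" using iso G.iso_sym unfolding P_def by blast
  then obtain \<phi> where \<phi>: "\<phi> \<in> iso P G" by (auto simp: is_iso_def)
  then have hom: "\<phi> \<in> hom P G" and bij: "bij_betw \<phi> (carrier P) (carrier G)" by (auto simp: iso_def)
  have "metacyclic_coords G n S (\<phi> \<circ> e)"
  proof (unfold_locales)
    show "0 < n" by (rule n)
    have "[int S * int S = s * s] (mod int n)" using n by (simp add: S_def cong_def mod_mult_eq)
    with s have "[int (S * S) = int 1] (mod int n)" by (simp add: power2_eq_square cong_def)
    then show "[S * S = 1] (mod n)" by (simp only: cong_int_iff)
    show "bij_betw (\<phi> \<circ> e) ({..<n} \<times> UNIV) (carrier G)" using e(1) bij by (rule bij_betw_trans)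
    show "(\<phi> \<circ> e) (0, False) = \<one>\<^bsub>G\<^esub>"
      using hom_one[OF hom grpP G] e(2) by simp
    show "(\<phi> \<circ> e) (i, b) \<otimes>\<^bsub>G\<^esub> (\<phi> \<circ> e) (j, c) = (\<phi> \<circ> e) ((i + (if b then S * j else j)) mod n, b \<noteq> c)"
      for i b j c
      using hom_mult[OF hom e_carr e_carr, of "(i, b)" "(j, c)"] by (simp add: e_mult)
  qed
  then show thesis using that unfolding S_def by blast
qed

lemma power_int_root_of_unity:
  fixes z :: "'a::field"
  assumes "z ^ n = 1" and "n > 0"
  shows "z powi s = z ^ nat (s mod int n)" and "z powi (s + 1) = z * z ^ nat (s mod int n)"
proof -
  have "z \<noteq> 0" using assms by (auto simp: zero_power)
  have "z powi s = z powi (int n * (s div int n) + s mod int n)" by simp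
  also have "\<dots> = (z powi int n) powi (s div int n) * z powi (s mod int n)"
    using \<open>z \<noteq> 0\<close> by (simp only: power_int_add power_int_mult simp_thms)
  also have "\<dots> = z powi (s mod int n)" using assms(1) by simp
  also have "\<dots> = z ^ nat (s mod int n)" using assms(2) by (simp add: power_int_def)
  finally show 1: "z powi s = z ^ nat (s mod int n)" .
  show "z powi (s + 1) = z * z ^ nat (s mod int n)"
    using \<open>z \<noteq> 0\<close> by (simp add: power_int_add 1)
qed

lemma exact_order_exists:
  fixes z :: "'k::field"
  assumes "z ^ m = 1" and "m > 0"
  obtains l where "primitive_root_of_unity l z" and "l dvd m"
proof -
  define l where "l = (LEAST k. 0 < k \<and> z ^ k = 1)"
  have l: "0 < l \<and> z ^ l = 1" unfolding l_def by (rule LeastI[of _ m]) (use assms in simp)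
  have "\<not> (0 < k \<and> z ^ k = 1)" if "k < l" for k
    using that not_less_Least unfolding l_def by blast
  with l have "primitive_root_of_unity l z" by (auto simp: primitive_root_of_unity_def)
  with assms that show thesis using primitive_root_power_eq_1_iff by blast
qed

text \<open>With \<open>l\<close> the exact order of \<open>z\<close>, a divisor of
  \<open>n\<close>, both sides say that \<open>l\<close> divides
  \<open>gcd (int n) (s - 1)\<close>.\<close>

lemma power_fixed_iff:
  fixes z :: "'k::field"
  assumes z: "z ^ n = 1" and n: "n > 0" and d: "int d = gcd (int n) (s - 1)"
  shows "z ^ nat (s mod int n) = z \<longleftrightarrow> z ^ d = 1"
proof -
  obtain l where l: "primitive_root_of_unity l z" "l dvd n" using exact_order_exists[OF z n] .
  have "int (nat (s mod int n)) = s mod int n" using n by simp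
  moreover have "[s mod int n = s] (mod int l)"
    using l(2) by (metis cong_mod_left cong_def mod_mod_cancel int_dvd_int_iff)
  ultimately have S: "[int (nat (s mod int n)) = s] (mod int l)" by simp
  have "z ^ nat (s mod int n) = z \<longleftrightarrow> [nat (s mod int n) = 1] (mod l)"
    using primitive_root_power_eq_iff[OF l(1), of _ 1] by simp
  also have "\<dots> \<longleftrightarrow> [int (nat (s mod int n)) = 1] (mod int l)"
    by (metis cong_int_iff of_nat_1)
  also have "\<dots> \<longleftrightarrow> [s = 1] (mod int l)" using S by (meson cong_trans cong_sym)
  also have "\<dots> \<longleftrightarrow> int l dvd gcd (int n) (s - 1)" using l(2) by (simp add: cong_iff_dvd_diff)
  also have "\<dots> \<longleftrightarrow> l dvd d" unfolding d[symmetric] by simp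
  finally show ?thesis by (simp add: primitive_root_power_eq_1_iff[OF l(1)])
qed

context coprime_galois_field
begin

lemma frob_power_eq_1_iff: "((z :: 'f alg_closure) ^ (q ^ k)) ^ m = 1 \<longleftrightarrow> z ^ m = 1"
proof -
  have "(z ^ (q ^ k)) ^ m = (z ^ m) ^ (q ^ k)" by (simp only: power_mult[symmetric] mult.commute)
  then show ?thesis using frob_inj[of "z ^ m" k 1] by auto
qed

lemma irreducible_dvd_monom_diff_1_iff:
  fixes f :: "'f poly"
  assumes "irreducible f" and "poly (map_poly to_ac f) z = 0"
  shows "f dvd monom 1 m - 1 \<longleftrightarrow> z ^ m = 1"
proof
  assume "f dvd monom 1 m - 1"
  from poly_to_ac_eq_0_if_dvd[OF this assms(2)] show "z ^ m = 1"
    by (simp add: map_poly_to_ac_monom_diff_1 poly_monom)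
next
  assume "z ^ m = 1"
  then have "poly (map_poly to_ac (monom 1 m - 1)) z = 0"
    by (simp add: map_poly_to_ac_monom_diff_1 poly_monom)
  then show "f dvd monom 1 m - 1" by (rule irreducible_dvd_if_common_root[OF assms])
qed

text \<open>A root of unity belongs to only one factor, because a root common to two factors would
  be a double root of x^n - 1; and the roots of one irreducible factor form a single Frobenius
  orbit.\<close>

lemma orbit_reps_of_factorization:
  fixes h :: "'i \<Rightarrow> 'f poly"
  assumes fin: "finite I" and prod: "monom 1 n - 1 = (\<Prod>p\<in>I. h p)"
    and irr: "\<And>p. p \<in> I \<Longrightarrow> irreducible (h p)"
    and root: "\<And>p. p \<in> I \<Longrightarrow> poly (map_poly to_ac (h p)) (\<zeta> p) = 0"
  shows "orbit_reps I \<zeta>"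
proof -
  let ?h = "\<lambda>p. map_poly to_ac (h p)"
  have prod_ac: "monom 1 n - 1 = (\<Prod>p\<in>I. ?h p)"
    using arg_cong[OF prod, of "map_poly to_ac"] by (simp add: map_poly_to_ac_monom_diff_1 map_poly_to_ac_prod)
  have unity: "z ^ n = 1 \<longleftrightarrow> (\<exists>p\<in>I. poly (?h p) z = 0)" for z
  proof -
    have "z ^ n = 1 \<longleftrightarrow> poly (monom 1 n - 1) z = 0" by (simp add: poly_monom)
    also have "\<dots> \<longleftrightarrow> (\<exists>p\<in>I. poly (?h p) z = 0)"
      unfolding prod_ac using fin by (simp add: poly_prod)
    finally show ?thesis .
  qed
  have uniq: "p = p'" if p: "p \<in> I" "p' \<in> I" and z: "poly (?h p) z = 0" "poly (?h p') z = 0" for p p' z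
  proof (rule ccontr)
    assume "p \<noteq> p'"
    then have "(\<Prod>p\<in>I. ?h p) = ?h p * (?h p' * (\<Prod>p\<in>I - {p} - {p'}. ?h p))"
      using fin p by (subst prod.remove[of I p], simp, simp) (subst prod.remove[of "I - {p}" p'], auto)
    moreover have "[:- z, 1:] * [:- z, 1:] dvd ?h p * ?h p'"
      using z by (intro mult_dvd_mono) (simp_all add: poly_eq_0_iff_dvd)
    ultimately have "[:- z, 1:] * [:- z, 1:] dvd (monom 1 n - 1 :: 'f alg_closure poly)"
      unfolding prod_ac by (simp only: mult.assoc[symmetric] dvd_mult2)
    with monom_diff_1_no_double_root show False by blast
  qed
  have conj: "poly (?h p) z = 0 \<longleftrightarrow> (\<exists>k. z = \<zeta> p ^ (q ^ k))" if p: "p \<in> I" for p z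
  proof
    assume "poly (?h p) z = 0"
    then show "\<exists>k. z = \<zeta> p ^ (q ^ k)" by (rule irreducible_roots_conjugate[OF irr[OF p] root[OF p]])
  next
    assume "\<exists>k. z = \<zeta> p ^ (q ^ k)"
    then show "poly (?h p) z = 0" using root[OF p] q_gt_1 by (auto simp: frob_poly_eval)
  qed
  show ?thesis
    unfolding orbit_reps_def
  proof (intro conjI ballI allI impI)
    show "\<zeta> p ^ n = 1" if "p \<in> I" for p using unity root that by blast
    fix z :: "'f alg_closure" assume "z ^ n = 1"
    then obtain p where "p \<in> I" "poly (?h p) z = 0" using unity by blast
    then show "\<exists>!p. p \<in> I \<and> (\<exists>k. z = \<zeta> p ^ (q ^ k))" using uniq conj by blast
  qed
qed

text \<open>Frobenius preserves the order of a root of unity, so \<open>z ^ d = 1\<close> singles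
  out whole orbits. They are the orbits of primitive l-th roots with l dividing \<open>d\<close>,
  and can be represented by \<open>Z\<close> instead of by the roots \<open>\<xi>\<close>.\<close>

lemma orbit_reps_replace_fixed:
  fixes \<xi> :: "nat \<Rightarrow> 'f alg_closure" and Z :: "nat \<Rightarrow> nat \<Rightarrow> 'f alg_closure"
  assumes reps: "orbit_reps (A \<times> {False} \<union> B \<times> UNIV) (\<lambda>(i, b). if b then \<xi> i ^ S else \<xi> i)"
    and AB: "A \<inter> B = {}" and d: "d > 0" "d dvd n"
    and \<xi>_S: "\<And>i. i \<in> B \<Longrightarrow> (\<xi> i ^ S) ^ S = \<xi> i"
    and Z: "\<And>l j. l dvd d \<Longrightarrow> j < c l \<Longrightarrow> primitive_root_of_unity l (Z l j)"
    and Z_reps: "\<And>l z. l dvd d \<Longrightarrow> primitive_root_of_unity l z \<Longrightarrow> \<exists>!j. j < c l \<and> (\<exists>k. z = Z l j ^ (q ^ k))"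
  shows "orbit_reps ((SIGMA l:{l. l dvd d}. {..<c l}) <+> {i \<in> A. \<xi> i ^ d \<noteq> 1} <+> {i \<in> B. \<xi> i ^ d \<noteq> 1} \<times> UNIV)
      (case_sum (\<lambda>(l, j). Z l j) (case_sum \<xi> (\<lambda>(i, b). if b then \<xi> i ^ S else \<xi> i)))"
    (is "orbit_reps ?J ?\<rho>")
proof -
  let ?I = "A \<times> {False} \<union> B \<times> (UNIV :: bool set)"
  let ?\<zeta> = "\<lambda>(i, b). if b then \<xi> i ^ S else \<xi> i"
  have \<zeta>_d: "?\<zeta> p ^ d = 1 \<longleftrightarrow> \<xi> (fst p) ^ d = 1" if "p \<in> ?I" for p
  proof -
    obtain i b where p: "p = (i, b)" by force
    have "(\<xi> i ^ S) ^ d = 1 \<longleftrightarrow> \<xi> i ^ d = 1" if "i \<in> B"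
    proof
      have comm: "(x ^ S) ^ d = (x ^ d) ^ S" for x :: "'f alg_closure"
        by (simp only: power_mult[symmetric] mult.commute)
      show "(\<xi> i ^ S) ^ d = 1" if "\<xi> i ^ d = 1" using that by (simp add: comm)
      show "\<xi> i ^ d = 1" if "(\<xi> i ^ S) ^ d = 1" using comm[of "\<xi> i ^ S"] \<xi>_S[OF \<open>i \<in> B\<close>] that by simp
    qed
    with \<open>p \<in> ?I\<close> show ?thesis by (auto simp: p)
  qed
  \<comment> \<open>Sends an old index to the new index of the same root. As \<open>A\<close> and
    \<open>B\<close> are disjoint, the first component alone decides between the second and the
    third block.\<close>
  define \<iota> :: "nat \<times> bool \<Rightarrow> nat \<times> nat + nat + nat \<times> bool"
    where "\<iota> = (\<lambda>p. if fst p \<in> A then Inr (Inl (fst p)) else Inr (Inr p))"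
  have \<iota>_\<rho>: "?\<rho> (\<iota> p) = ?\<zeta> p" if "p \<in> ?I" for p
    using that AB by (auto simp: \<iota>_def)
  have Inr_J: "\<exists>p\<in>?I. Inr y = \<iota> p \<and> \<xi> (fst p) ^ d \<noteq> 1" if "Inr y \<in> ?J" for y
  proof (cases y)
    case (Inl i)
    with that have "i \<in> A" "\<xi> i ^ d \<noteq> 1" by auto
    then show ?thesis by (intro bexI[of _ "(i, False)"]) (auto simp: \<iota>_def Inl)
  next
    case (Inr p)
    with that have "p \<in> B \<times> UNIV" "\<xi> (fst p) ^ d \<noteq> 1" by auto
    then show ?thesis using AB by (intro bexI[of _ p]) (auto simp: \<iota>_def Inr)
  qed
  have \<iota>_J: "\<iota> p \<in> ?J" if "p \<in> ?I" "\<xi> (fst p) ^ d \<noteq> 1" for p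
    using that AB by (auto simp: \<iota>_def)
  show ?thesis
    unfolding orbit_reps_def
  proof (intro conjI ballI allI impI)
    fix j assume "j \<in> ?J"
    show "?\<rho> j ^ n = 1"
    proof (cases j)
      case (Inl p)
      with \<open>j \<in> ?J\<close> obtain l m where p: "p = (l, m)" "l dvd d" "m < c l" by auto
      then show ?thesis
        using primitive_root_power_eq_1_iff[OF Z[OF p(2,3)]] d by (auto simp: Inl intro: dvd_trans)
    next
      case (Inr y)
      with \<open>j \<in> ?J\<close> Inr_J obtain p where "p \<in> ?I" "j = \<iota> p" by blast
      then show ?thesis using reps \<iota>_\<rho> unfolding orbit_reps_def by auto
    qed
  next
    fix z :: "'f alg_closure" assume z: "z ^ n = 1"
    have ex1: "\<exists>!p. p \<in> ?I \<and> (\<exists>k. z = ?\<zeta> p ^ (q ^ k))"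
      using reps z unfolding orbit_reps_def by blast
    from ex1_implies_ex[OF this] obtain p
      where "p \<in> ?I \<and> (\<exists>k. z = ?\<zeta> p ^ (q ^ k))" ..
    note p = conjunct1[OF this] conjunct2[OF this]
    have p_uniq: "p' = p" if "p' \<in> ?I" "\<exists>k. z = ?\<zeta> p' ^ (q ^ k)" for p'
      using ex1 p that by blast
    have z_d: "z ^ d = 1 \<longleftrightarrow> \<xi> (fst p) ^ d = 1"
    proof -
      from p(2) obtain k where "z = ?\<zeta> p ^ (q ^ k)" by blast
      then have "z ^ d = 1 \<longleftrightarrow> ?\<zeta> p ^ d = 1" by (simp only: frob_power_eq_1_iff)
      then show ?thesis using \<zeta>_d[OF p(1)] by simp
    qed
    show "\<exists>!j. j \<in> ?J \<and> (\<exists>k. z = ?\<rho> j ^ (q ^ k))"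
    proof (cases "z ^ d = 1")
      case True
      obtain l where l: "primitive_root_of_unity l z" "l dvd d" using exact_order_exists[OF True d(1)] .
      note ex1_m = Z_reps[OF l(2,1)]
      from ex1_implies_ex[OF this] obtain m where m: "m < c l \<and> (\<exists>k. z = Z l m ^ (q ^ k))" ..
      have m_uniq: "m' = m" if "m' < c l" "\<exists>k. z = Z l m' ^ (q ^ k)" for m'
        using ex1_m m that by blast
      show ?thesis
      proof (rule ex1I[of _ "Inl (l, m)"])
        show "Inl (l, m) \<in> ?J \<and> (\<exists>k. z = ?\<rho> (Inl (l, m)) ^ (q ^ k))" using l m by auto
        fix j assume j: "j \<in> ?J \<and> (\<exists>k. z = ?\<rho> j ^ (q ^ k))"
        show "j = Inl (l, m)"
        proof (cases j)
          case (Inl p')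
          with j obtain l' m' k where p': "p' = (l', m')" "l' dvd d" "m' < c l'" "z = Z l' m' ^ (q ^ k)"
            by auto
          have "z ^ i = 1 \<longleftrightarrow> l' dvd i" for i
            unfolding p'(4) frob_power_eq_1_iff by (rule primitive_root_power_eq_1_iff[OF Z[OF p'(2,3)]])
          \<comment> \<open>The divisor is recovered from \<open>z\<close> as its exact order, which
            all Frobenius conjugates share.\<close>
          then have "l' = l" using primitive_root_power_eq_1_iff[OF l(1)] by (metis dvd_antisym dvd_refl)
          with p' m_uniq Inl show ?thesis by auto
        next
          case (Inr y)
          with j Inr_J obtain p' where p': "p' \<in> ?I" "j = \<iota> p'" "\<xi> (fst p') ^ d \<noteq> 1" by blast
          then have "p' = p" using j p_uniq \<iota>_\<rho> by simp
          with p' True z_d show ?thesis by simp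
        qed
      qed
    next
      case False
      then have nd: "\<xi> (fst p) ^ d \<noteq> 1" using z_d by simp
      show ?thesis
      proof (rule ex1I[of _ "\<iota> p"])
        show "\<iota> p \<in> ?J \<and> (\<exists>k. z = ?\<rho> (\<iota> p) ^ (q ^ k))" using \<iota>_J[OF p(1) nd] p \<iota>_\<rho> by simp
        fix j assume j: "j \<in> ?J \<and> (\<exists>k. z = ?\<rho> j ^ (q ^ k))"
        show "j = \<iota> p"
        proof (cases j)
          case (Inl p')
          with j obtain l' m' k where p': "p' = (l', m')" "l' dvd d" "m' < c l'" "z = Z l' m' ^ (q ^ k)"
            by auto
          then have "z ^ d = 1"
            using primitive_root_power_eq_1_iff[OF Z[OF p'(2,3)]] by (simp add: frob_power_eq_1_iff)
          with False show ?thesis by simp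
        next
          case (Inr y)
          with j Inr_J obtain p' where p': "p' \<in> ?I" "j = \<iota> p'" by blast
          then show ?thesis using j p_uniq \<iota>_\<rho> by simp
        qed
      qed
    qed
  qed
qed

end

theorem theorem3p1:
  fixes G :: "('g, 'm) monoid_scheme"
    and f :: "nat \<Rightarrow> 'f::finite_field poly"
    and \<xi> \<theta> :: "nat \<Rightarrow> 'f alg_closure"
    and n q d r t :: nat
    and s :: int
  assumes "primepow q" and "CARD('f) = q"
    and "group G" and "G \<cong> presented_group (split_metacyclic_rels n s)" and "\<not> comm_group G"
    and "[s\<^sup>2 = 1] (mod int n)" and "gcd (2 * n) q = 1"
    and "int d = gcd (int n) (s - 1)"
    and "monom 1 n - 1 = (\<Prod>i\<in>{1..r}. f i) * (\<Prod>i\<in>{r+1..r+t}. f i * involution s (f i))"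
    and "\<forall>i\<in>{1..r+t}. lead_coeff (f i) = 1 \<and> irreducible (f i)"
    and "\<forall>i\<in>{r+1..r+t}. lead_coeff (involution s (f i)) = 1 \<and> irreducible (involution s (f i))"
    and "f ` {1..r} =
      {g. lead_coeff g = 1 \<and> irreducible g \<and> g dvd monom 1 n - 1 \<and> self_involutive s g}"
    and "\<forall>i\<in>{r+1..r+t}. f i \<noteq> involution s (f i)"
    and "\<forall>i\<in>{1..r+t}. poly (map_poly to_ac (f i)) (\<xi> i) = 0"
    and "\<forall>l. l dvd d \<longrightarrow> primitive_root_of_unity l (\<theta> l)"
  shows "group_algebra G \<cong>\<^sub>a\<^sub>l\<^sub>g
      direct_sum {l. l dvd d}
        (\<lambda>l. copies (2 * (totient l div ord l q)) (field_algebra (adjoin {\<theta> l})))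
    \<boxplus> direct_sum {i\<in>{1..r}. \<not> f i dvd monom 1 d - 1}
        (\<lambda>i. mat2_algebra (adjoin {\<xi> i + \<xi> i powi s, \<xi> i powi (s + 1)}))
    \<boxplus> direct_sum {i\<in>{r+1..r+t}. \<not> f i dvd monom 1 d - 1}
        (\<lambda>i. mat2_algebra (adjoin {\<xi> i}))"
proof -
  have q1: "q > 1" using assms(1) by (rule primepow_gt_Suc_0[unfolded One_nat_def[symmetric]])
  \<comment> \<open>For \<open>n = 0\<close> the gcd would be \<open>q\<close>, which exceeds
    1.\<close>
  have n: "n > 0" using assms(7) q1 by (auto intro: Nat.gr0I)
  have "coprime (2 * n) q" using assms(7) by (simp only: coprime_iff_gcd_eq_1)
  then have "coprime n q" and odd: "odd q" by simp_all
  interpret coprime_galois_field "TYPE('f)" q n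
    by unfold_locales (use assms(1,2) n \<open>coprime n q\<close> in auto)
  define S where "S = nat (s mod int n)"
  obtain e where coords: "metacyclic_coords G n S e"
    using metacyclic_coords_of_presentation[OF assms(3,4) n assms(6)] unfolding S_def .
  interpret M: metacyclic_coords G n S e by (rule coords)
  have d_dvd: "d dvd n" by (metis assms(8) gcd_dvd1 int_dvd_int_iff)
  have d_pos: "d > 0" using d_dvd n by (metis dvd_0_left_iff neq0_conv)
  have f_irr: "irreducible (f i)" and f_root: "poly (map_poly to_ac (f i)) (\<xi> i) = 0" if "i \<in> {1..r+t}" for i
    using assms(10,14) that by auto
  have f_nz: "f i \<noteq> 0" if "i \<in> {1..r+t}" for i using f_irr[OF that] by auto

  \<comment> \<open>The index \<open>(i, True)\<close> stands for the involution of
    \<open>f i\<close>, with root \<open>\<xi> i ^ S\<close>; self-involutive factors occur only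
    with \<open>False\<close>.\<close>
  define I where "I = {1..r} \<times> {False} \<union> {r+1..r+t} \<times> (UNIV :: bool set)"
  define h where "h = (\<lambda>(i, b). if b then involution s (f i) else f i)"
  have prod: "monom 1 n - 1 = (\<Prod>p\<in>I. h p)"
  proof -
    have "(\<Prod>p\<in>I. h p) = (\<Prod>p\<in>{1..r} \<times> {False}. h p) * (\<Prod>p\<in>{r+1..r+t} \<times> UNIV. h p)"
      unfolding I_def by (rule prod.union_disjoint) auto
    also have "(\<Prod>p\<in>{1..r} \<times> {False}. h p) = (\<Prod>i\<in>{1..r}. f i)"
      by (rule prod.reindex_bij_witness[of _ "\<lambda>i. (i, False)" fst]) (auto simp: h_def)
    also have "(\<Prod>p\<in>{r+1..r+t} \<times> UNIV. h p) = (\<Prod>i\<in>{r+1..r+t}. \<Prod>b\<in>UNIV. h (i, b))"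
      by (simp only: prod.cartesian_product) (rule prod.cong, auto)
    also have "\<dots> = (\<Prod>i\<in>{r+1..r+t}. f i * involution s (f i))"
      by (rule prod.cong) (simp_all add: UNIV_bool h_def mult.commute)
    finally show ?thesis using assms(9) by simp
  qed
  have f_dvd: "f i dvd monom 1 n - 1" if i: "i \<in> {1..r+t}" for i
  proof -
    have "(i, False) \<in> I" using i by (auto simp: I_def)
    then have "h (i, False) dvd (\<Prod>p\<in>I. h p)" by (intro dvd_prodI) (auto simp: I_def)
    then show ?thesis unfolding prod by (simp add: h_def)
  qed
  have \<xi>_n: "\<xi> i ^ n = 1" if "i \<in> {1..r+t}" for i
    using irreducible_dvd_monom_diff_1_iff[OF f_irr f_root] f_dvd that by blast
  have \<xi>_powi: "\<xi> i powi s = \<xi> i ^ S" and \<xi>_powi': "\<xi> i powi (s + 1) = \<xi> i * \<xi> i ^ S" if "i \<in> {1..r+t}" for i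
    using power_int_root_of_unity[OF \<xi>_n[OF that] n] by (simp_all add: S_def)
  have involution_root: "poly (map_poly to_ac (involution s (f i))) (\<xi> i ^ S) = 0" if i: "i \<in> {1..r+t}" for i
    using poly_involution_eq_0_iff[OF f_nz[OF i]] f_root[OF i] \<xi>_powi[OF i] by metis
  have "orbit_reps I (\<lambda>(i, b). if b then \<xi> i ^ S else \<xi> i)"
  proof (rule orbit_reps_of_factorization[OF _ prod])
    show "finite I" by (simp add: I_def)
    show "irreducible (h p)" if "p \<in> I" for p
      using that f_irr assms(11) by (auto simp: I_def h_def)
    show "poly (map_poly to_ac (h p)) (case p of (i, b) \<Rightarrow> if b then \<xi> i ^ S else \<xi> i) = 0"
      if "p \<in> I" for p
      using that f_root involution_root by (auto simp: I_def h_def)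
  qed
  note reps = this[unfolded I_def]

  define c where "c l = totient l div ord l q" for l
  have "\<forall>l\<in>{l. l dvd d}. \<exists>Zl. (\<forall>j<c l. primitive_root_of_unity l (Zl j :: 'f alg_closure)) \<and>
      (\<forall>z. primitive_root_of_unity l z \<longrightarrow> (\<exists>!j. j < c l \<and> (\<exists>k. z = Zl j ^ (q ^ k))))"
  proof
    fix l assume "l \<in> {l. l dvd d}"
    then have prim: "primitive_root_of_unity l (\<theta> l)" and "l dvd n" using assms(15) d_dvd by auto
    from this(2) have "coprime l q" using \<open>coprime n q\<close> by (metis coprime_divisors dvd_refl)
    show "\<exists>Zl. (\<forall>j<c l. primitive_root_of_unity l (Zl j :: 'f alg_closure)) \<and>
      (\<forall>z. primitive_root_of_unity l z \<longrightarrow> (\<exists>!j. j < c l \<and> (\<exists>k. z = Zl j ^ (q ^ k))))"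
    proof (rule primitive_root_orbit_reps[OF prim \<open>coprime l q\<close>])
      fix Zl :: "nat \<Rightarrow> 'f alg_closure"
      assume "\<And>j. j < totient l div ord l q \<Longrightarrow> primitive_root_of_unity l (Zl j)"
        and "\<And>z. primitive_root_of_unity l z \<Longrightarrow>
          \<exists>!j. j < totient l div ord l q \<and> (\<exists>k. z = Zl j ^ (q ^ k))"
      then show "\<exists>Zl. (\<forall>j<c l. primitive_root_of_unity l (Zl j :: 'f alg_closure)) \<and>
        (\<forall>z. primitive_root_of_unity l z \<longrightarrow> (\<exists>!j. j < c l \<and> (\<exists>k. z = Zl j ^ (q ^ k))))"
        unfolding c_def by (intro exI[of _ Zl] conjI allI impI)
    qed
  qed
  from bchoice[OF this] obtain Z where Z: "\<forall>l\<in>{l. l dvd d}.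
      (\<forall>j<c l. primitive_root_of_unity l (Z l j :: 'f alg_closure)) \<and>
      (\<forall>z. primitive_root_of_unity l z \<longrightarrow> (\<exists>!j. j < c l \<and> (\<exists>k. z = Z l j ^ (q ^ k))))" ..
  then have Z_prim: "primitive_root_of_unity l (Z l j)" if "l dvd d" "j < c l" for l j using that by blast

  have IA: "{i\<in>{1..r}. \<not> f i dvd monom 1 d - 1} = {i\<in>{1..r}. \<xi> i ^ d \<noteq> 1}"
    using irreducible_dvd_monom_diff_1_iff[OF f_irr f_root] by auto
  have IB: "{i\<in>{r+1..r+t}. \<not> f i dvd monom 1 d - 1} = {i\<in>{r+1..r+t}. \<xi> i ^ d \<noteq> 1}"
    using irreducible_dvd_monom_diff_1_iff[OF f_irr f_root] by auto

  have "group_algebra G \<cong>\<^sub>a\<^sub>l\<^sub>g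
      direct_sum {l. l dvd d} (\<lambda>l. copies (2 * c l) (field_algebra (adjoin {\<theta> l})))
    \<boxplus> direct_sum {i\<in>{1..r}. \<xi> i ^ d \<noteq> 1} (\<lambda>i. mat2_algebra (adjoin {\<xi> i + \<xi> i ^ S, \<xi> i * \<xi> i ^ S}))
    \<boxplus> direct_sum {i\<in>{r+1..r+t}. \<xi> i ^ d \<noteq> 1} (\<lambda>i. mat2_algebra (adjoin {\<xi> i}))"
  proof (rule group_algebra_decomposition[OF coords odd])
    show "orbit_reps
        ((SIGMA l:{l. l dvd d}. {..<c l}) <+> {i\<in>{1..r}. \<xi> i ^ d \<noteq> 1} <+> {i\<in>{r+1..r+t}. \<xi> i ^ d \<noteq> 1} \<times> UNIV)
        (case_sum (\<lambda>(l, j). Z l j) (case_sum \<xi> (\<lambda>(i, b). if b then \<xi> i ^ S else \<xi> i)))"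
    proof (rule orbit_reps_replace_fixed[OF reps _ d_pos d_dvd])
      show "(\<xi> i ^ S) ^ S = \<xi> i" if "i \<in> {r+1..r+t}" for i
        using M.power_S_S[OF \<xi>_n] that by simp
    qed (use Z in auto)
    fix l j assume "l \<in> {l. l dvd d}" and j: "j < c l"
    then have l: "l dvd d" by simp
    note prim = Z_prim[OF l j]
    have "Z l j ^ d = 1" "Z l j ^ n = 1"
      using primitive_root_power_eq_1_iff[OF prim] l d_dvd by (auto intro: dvd_trans)
    then show "Z l j ^ S = Z l j" unfolding S_def using power_fixed_iff n assms(8) by blast
    have \<theta>: "primitive_root_of_unity l (\<theta> l)" using assms(15) l by blast
    have "Z l j ^ l = 1" "\<theta> l ^ l = 1" using prim \<theta> by (simp_all add: primitive_root_of_unity_def)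
    \<comment> \<open>Two primitive roots of the same order are powers of each other, so it does not
      matter which one is adjoined.\<close>
    then obtain i k where "Z l j = \<theta> l ^ i" "\<theta> l = Z l j ^ k"
      using roots_of_unity_powers_of_primitive_root[OF prim] roots_of_unity_powers_of_primitive_root[OF \<theta>]
      by metis
    then show "adjoin {Z l j} = adjoin {\<theta> l}" by (intro adjoin_singleton_powers_eq)
  next
    fix i assume "i \<in> {i\<in>{1..r}. \<xi> i ^ d \<noteq> 1}"
    then have i: "i \<in> {1..r}" "i \<in> {1..r+t}" and "\<xi> i ^ d \<noteq> 1" by auto
    then show "\<xi> i ^ S \<noteq> \<xi> i" unfolding S_def using power_fixed_iff[OF \<xi>_n n assms(8)] by blast
    \<comment> \<open>\<open>\<xi> i ^ S\<close> is a root of the involution of \<open>f i\<close>,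
      hence of \<open>f i\<close> itself, and the roots of an irreducible polynomial are
      conjugate.\<close>
    have "self_involutive s (f i)" using assms(12) i(1) by blast
    then have "poly (map_poly to_ac (f i)) (\<xi> i ^ S) = 0"
      using involution_root[OF i(2)] unfolding self_involutive_def by blast
    then show "\<exists>k. \<xi> i ^ S = \<xi> i ^ (q ^ k)"
      by (rule irreducible_roots_conjugate[OF f_irr[OF i(2)] f_root[OF i(2)]])
  qed
  \<comment> \<open>The integer powers agree with the natural ones at n-th roots of unity, which
    \<open>\<xi> i\<close> is known to be for indices in range.\<close>
  moreover have "direct_sum {i\<in>{1..r}. \<xi> i ^ d \<noteq> 1} (\<lambda>i. mat2_algebra (adjoin {\<xi> i + \<xi> i ^ S, \<xi> i * \<xi> i ^ S}))
      = direct_sum {i\<in>{1..r}. \<xi> i ^ d \<noteq> 1} (\<lambda>i. mat2_algebra (adjoin {\<xi> i + \<xi> i powi s, \<xi> i powi (s + 1)}))"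
    by (rule direct_sum_cong) (simp add: \<xi>_powi \<xi>_powi')
  ultimately show ?thesis unfolding IA IB c_def by simp
qed

end
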